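(* Let $(M,\widetilde B)$ be a root of unity quantum seed satisfying condition (Coprime), and $\mathrm{inv}\subseteq[1,N]\setminus\mathrm{ex}$. Let $\mathcal C(M,\widetilde B,\mathrm{inv})$ be the $\mathbb Z$-subring of $\mathcal A_\varepsilon(M,\widetilde B,\mathrm{inv})$ generated by the elements $M'(e_i)^\ell$ and $M'(e_j)^{-\ell}$ for all root of unity quantum seeds $(M',\widetilde B')$ mutation-equivalent to $(M,\widetilde B)$, $i\in[1,N]$, $j\in\mathrm{inv}$. Then $\mathcal C(M,\widetilde B,\mathrm{inv})$ is isomorphic to the classical cluster algebra $\mathcal A(\widetilde B,\mathrm{inv})$.
   Context: Let $\ell$ be a positive integer, $\mathbb Z_\ell=\mathbb Z/\ell\mathbb Z$, $\varepsilon^{1/2}\in\mathbb C$ a primitive $\ell$-th root of unity, $\varepsilon=(\varepsilon^{1/2})^2$, $\mathcal A^{1/2}_\varepsilon=\mathbb Z[\varepsilon^{1/2}]$, and $\varepsilon^{a/2}=(\varepsilon^{1/2})^a$ for $a\in\mathbb Z_\ell$. $\overline C$ is the reduction mod $\ell$ of an integer matrix $C$; $e_1,\dots,e_N$ is the standard basis of $\mathbb Z^N$. For a skew-symmetric bilinear form $\Lambda:\mathbb Z^N\times\mathbb Z^N\to\mathbb Z_\ell$ with matrix $(\lambda_{ij})$, $\mathcal T_\varepsilon(\Lambda)$ is the $\mathcal A^{1/2}_\varepsilon$-algebra with basis $\{X^f\}_{f\in\mathbb Z^N}$ and $X^fX^g=\varepsilon^{\Lambda(f,g)/2}X^{f+g}$.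 A root of unity toric frame of a division algebra $\mathcal F$ over $\mathbb Q(\varepsilon^{1/2})$ is a map $M:\mathbb Z^N\to\mathcal F$ such that for some (unique) skew-symmetric $\Lambda=:\Lambda_M$ there is an injective $\mathcal A^{1/2}_\varepsilon$-algebra map $\phi:\mathcal T_\varepsilon(\Lambda)\to\mathcal F$, $\phi(X^f)=M(f)$, with $\mathcal F$ the skew field of fractions of its image. Fix $\mathrm{ex}\subseteq[1,N]$. An exchange matrix $\widetilde B=(b_{ij})$ is an integer matrix with rows indexed by $[1,N]$, columns by $\mathrm{ex}$, principal part $B$ (its $\mathrm{ex}\times\mathrm{ex}$ submatrix), $k$-th column $b^k$. $(\Lambda,\widetilde B)$ is $\ell$-compatible if there is $D=\mathrm{diag}(d_j)_{j\in\mathrm{ex}}$, $d_j\in\mathbb Z_{>0}$, with $DB$ skew-symmetric and $\sum_k\overline b_{kj}\lambda_{ki}=\delta_{ij}\overline d_j$ in $\mathbb Z_\ell$ for all $i\in[1,N]$, $j\in\mathrm{ex}$. A root of unity quantum seed is $(M,\widetilde B)$ with $(\Lambda_M,\widetilde B)$ $\ell$-compatible. Condition (Coprime): $\ell$ is odd and coprime to all $d_k$, $k\in\mathrm{ex}$, for this $D$. For $b\in\mathbb Z^N$, $[b]_\pm$ keeps the entries $b_i$ with $\pm b_i\ge0$ and sets the others to $0$. Mutation in direction $k\in\mathrm{ex}$: $\mu_k(\widetilde B)=(b'_{ij})$, $b'_{ij}=-b_{ij}$ if $i=k$ or $j=k$, otherwise $b'_{ij}=b_{ij}+(|b_{ik}|b_{kj}+b_{ik}|b_{kj}|)/2$;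 $\mu_k(M)$ is the root of unity toric frame with matrix $\overline E^\top\Lambda_M\overline E$ ($E$: $e_{ij}=\delta_{ij}$ for $j\neq k$, $e_{kk}=-1$, $e_{ik}=\max(0,-b_{ik})$ for $i\ne k$) and $\mu_k(M)(e_j)=M(e_j)$ ($j\ne k$), $\mu_k(M)(e_k)=M(-e_k+[b^k]_+)+M(-e_k-[b^k]_-)$. Mutation-equivalence is generated by mutations. For $\mathrm{inv}\subseteq[1,N]\setminus\mathrm{ex}$, $\mathcal A_\varepsilon(M,\widetilde B,\mathrm{inv})$ is the $\mathcal A^{1/2}_\varepsilon$-subalgebra of $\mathcal F$ generated by all $M'(e_i)$ over all seeds $(M',\widetilde B')$ mutation-equivalent to $(M,\widetilde B)$ and by $M(e_j)^{-1}$, $j\in\mathrm{inv}$. The classical cluster algebra $\mathcal A(\widetilde B,\mathrm{inv})$: in $\mathbb Q(x_1,\dots,x_N)$, start with the seed $((x_1,\dots,x_N),\widetilde B)$; mutation in direction $k\in\mathrm{ex}$ replaces $x_k$ by $x_k'$ with $x_kx_k'=\prod_{b_{ik}>0}x_i^{b_{ik}}+\prod_{b_{ik}<0}x_i^{-b_{ik}}$ and $\widetilde B$ by $\mu_k(\widetilde B)$; $\mathcal A(\widetilde B,\mathrm{inv})$ is the subring generated by all cluster variables of all mutation-equivalent seeds and by $x_j^{-1}$, $j\in\mathrm{inv}$. *)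

theory Defs
  imports Complex_Main "HOL-Library.Poly_Mapping" "HOL-Computational_Algebra.Fraction_Field"
begin

inductive_set ring_gen :: "'a::ring_1 set \<Rightarrow> 'a set" for S where
  rg_base: "x \<in> S \<Longrightarrow> x \<in> ring_gen S"
| rg_one: "1 \<in> ring_gen S"
| rg_add: "x \<in> ring_gen S \<Longrightarrow> y \<in> ring_gen S \<Longrightarrow> x + y \<in> ring_gen S"
| rg_neg: "x \<in> ring_gen S \<Longrightarrow> - x \<in> ring_gen S"
| rg_mult: "x \<in> ring_gen S \<Longrightarrow> y \<in> ring_gen S \<Longrightarrow> x * y \<in> ring_gen S"

inductive_set divring_gen :: "'a::division_ring set \<Rightarrow> 'a set" for S where
  dg_base: "x \<in> S \<Longrightarrow> x \<in> divring_gen S"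
| dg_one: "1 \<in> divring_gen S"
| dg_add: "x \<in> divring_gen S \<Longrightarrow> y \<in> divring_gen S \<Longrightarrow> x + y \<in> divring_gen S"
| dg_neg: "x \<in> divring_gen S \<Longrightarrow> - x \<in> divring_gen S"
| dg_mult: "x \<in> divring_gen S \<Longrightarrow> y \<in> divring_gen S \<Longrightarrow> x * y \<in> divring_gen S"
| dg_inv: "x \<in> divring_gen S \<Longrightarrow> inverse x \<in> divring_gen S"

abbreviation Qz :: "complex \<Rightarrow> complex set" where "Qz z \<equiv> divring_gen {z}"
abbreviation Zz :: "complex \<Rightarrow> complex set" where "Zz z \<equiv> ring_gen {z}"

definition primitive_root :: "nat \<Rightarrow> complex \<Rightarrow> bool" where
  "primitive_root l z \<longleftrightarrow> z ^ l = 1 \<and> (\<forall>m. 0 < m \<and> m < l \<longrightarrow> z ^ m \<noteq> 1)"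

definition Qz_algebra :: "complex \<Rightarrow> (complex \<Rightarrow> 'f::division_ring) \<Rightarrow> bool" where
  "Qz_algebra z \<sigma> \<longleftrightarrow> \<sigma> 1 = 1 \<and>
     (\<forall>a\<in>Qz z. \<forall>b\<in>Qz z. \<sigma> (a + b) = \<sigma> a + \<sigma> b \<and> \<sigma> (a * b) = \<sigma> a * \<sigma> b) \<and>
     (\<forall>a\<in>Qz z. \<forall>y. \<sigma> a * y = y * \<sigma> a)"

definition ZN :: "nat \<Rightarrow> (nat \<Rightarrow> int) set" where
  "ZN N = {f. \<forall>i\<ge>N. f i = 0}"

definition ev :: "nat \<Rightarrow> nat \<Rightarrow> int" where
  "ev i = (\<lambda>j. if j = i then 1 else 0)"

text \<open>The bilinear form with integer matrix lam (its value is read in Z_l).\<close>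
definition bform :: "nat \<Rightarrow> (nat \<Rightarrow> nat \<Rightarrow> int) \<Rightarrow> (nat \<Rightarrow> int) \<Rightarrow> (nat \<Rightarrow> int) \<Rightarrow> int" where
  "bform N lam f g = (\<Sum>i<N. \<Sum>j<N. f i * lam i j * g j)"

text \<open>zeta^a for a in Z_l (i.e. epsilon^(a/2)).\<close>
definition zpow :: "nat \<Rightarrow> complex \<Rightarrow> int \<Rightarrow> complex" where
  "zpow l z a = z ^ nat (a mod int l)"

definition skew_mod :: "nat \<Rightarrow> nat \<Rightarrow> (nat \<Rightarrow> nat \<Rightarrow> int) \<Rightarrow> bool" where
  "skew_mod l N lam \<longleftrightarrow> (\<forall>i<N. \<forall>j<N. (lam i j + lam j i) mod int l = 0)"

text \<open>M is a root of unity toric frame with matrix lam: the map X^f |-> M f extends to an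
  injective Z[zeta]-algebra map from T_eps(Lambda) (i.e. the M f satisfy the quasi-commutation
  relations, M 0 = 1, and they are linearly independent over Z[zeta]), and F is the division
  ring generated by the image.\<close>
definition toric_frame :: "nat \<Rightarrow> complex \<Rightarrow> (complex \<Rightarrow> 'f::division_ring) \<Rightarrow> nat \<Rightarrow>
    ((nat \<Rightarrow> int) \<Rightarrow> 'f) \<Rightarrow> (nat \<Rightarrow> nat \<Rightarrow> int) \<Rightarrow> bool" where
  "toric_frame l z \<sigma> N M lam \<longleftrightarrow>
     skew_mod l N lam \<and>
     M (\<lambda>_. 0) = 1 \<and>
     (\<forall>f\<in>ZN N. \<forall>g\<in>ZN N. M f * M g = \<sigma> (zpow l z (bform N lam f g)) * M (\<lambda>i. f i + g i)) \<and>
     (\<forall>S c. finite S \<and> S \<subseteq> ZN N \<and> (\<forall>f\<in>S. c f \<in> Zz z) \<and>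
        (\<Sum>f\<in>S. \<sigma> (c f) * M f) = 0 \<longrightarrow> (\<forall>f\<in>S. c f = 0)) \<and>
     divring_gen (M ` ZN N \<union> \<sigma> ` Zz z) = UNIV"

definition l_compatible :: "nat \<Rightarrow> nat \<Rightarrow> nat set \<Rightarrow> (nat \<Rightarrow> nat \<Rightarrow> int) \<Rightarrow>
    (nat \<Rightarrow> nat \<Rightarrow> int) \<Rightarrow> (nat \<Rightarrow> int) \<Rightarrow> bool" where
  "l_compatible l N ex lam B D \<longleftrightarrow>
     (\<forall>j\<in>ex. D j > 0) \<and>
     (\<forall>i\<in>ex. \<forall>j\<in>ex. D i * B i j = - (D j * B j i)) \<and>
     (\<forall>i<N. \<forall>j\<in>ex. (\<Sum>k<N. B k j * lam k i) mod int l = (if i = j then D j else 0) mod int l)"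

definition quantum_seed :: "nat \<Rightarrow> complex \<Rightarrow> (complex \<Rightarrow> 'f::division_ring) \<Rightarrow> nat \<Rightarrow> nat set \<Rightarrow>
    ((nat \<Rightarrow> int) \<Rightarrow> 'f) \<Rightarrow> (nat \<Rightarrow> nat \<Rightarrow> int) \<Rightarrow> bool" where
  "quantum_seed l z \<sigma> N ex M B \<longleftrightarrow>
     (\<exists>lam D. toric_frame l z \<sigma> N M lam \<and> l_compatible l N ex lam B D)"

definition coprime_seed :: "nat \<Rightarrow> complex \<Rightarrow> (complex \<Rightarrow> 'f::division_ring) \<Rightarrow> nat \<Rightarrow> nat set \<Rightarrow>
    ((nat \<Rightarrow> int) \<Rightarrow> 'f) \<Rightarrow> (nat \<Rightarrow> nat \<Rightarrow> int) \<Rightarrow> bool" where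
  "coprime_seed l z \<sigma> N ex M B \<longleftrightarrow>
     (\<exists>lam D. toric_frame l z \<sigma> N M lam \<and> l_compatible l N ex lam B D \<and>
        odd l \<and> (\<forall>k\<in>ex. coprime (int l) (D k)))"

definition mutB :: "nat \<Rightarrow> (nat \<Rightarrow> nat \<Rightarrow> int) \<Rightarrow> nat \<Rightarrow> nat \<Rightarrow> int" where
  "mutB k B i j = (if i = k \<or> j = k then - B i j
                   else B i j + (\<bar>B i k\<bar> * B k j + B i k * \<bar>B k j\<bar>) div 2)"

definition Emat :: "(nat \<Rightarrow> nat \<Rightarrow> int) \<Rightarrow> nat \<Rightarrow> nat \<Rightarrow> nat \<Rightarrow> int" where
  "Emat B k i j = (if j \<noteq> k then (if i = j then 1 else 0)
                   else if i = k then -1 else max 0 (- B i k))"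

definition mut_lam :: "nat \<Rightarrow> (nat \<Rightarrow> nat \<Rightarrow> int) \<Rightarrow> nat \<Rightarrow> (nat \<Rightarrow> nat \<Rightarrow> int) \<Rightarrow> nat \<Rightarrow> nat \<Rightarrow> int" where
  "mut_lam N B k lam i j = (\<Sum>p<N. \<Sum>q<N. Emat B k p i * lam p q * Emat B k q j)"

definition colpos :: "nat \<Rightarrow> (nat \<Rightarrow> nat \<Rightarrow> int) \<Rightarrow> nat \<Rightarrow> nat \<Rightarrow> int" where
  "colpos N B k = (\<lambda>i. if i < N \<and> B i k \<ge> 0 then B i k else 0)"
definition colneg :: "nat \<Rightarrow> (nat \<Rightarrow> nat \<Rightarrow> int) \<Rightarrow> nat \<Rightarrow> nat \<Rightarrow> int" where
  "colneg N B k = (\<lambda>i. if i < N \<and> B i k \<le> 0 then B i k else 0)"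

definition qmut_step :: "nat \<Rightarrow> complex \<Rightarrow> (complex \<Rightarrow> 'f::division_ring) \<Rightarrow> nat \<Rightarrow> nat set \<Rightarrow>
    ((nat \<Rightarrow> int) \<Rightarrow> 'f) \<times> (nat \<Rightarrow> nat \<Rightarrow> int) \<Rightarrow> ((nat \<Rightarrow> int) \<Rightarrow> 'f) \<times> (nat \<Rightarrow> nat \<Rightarrow> int) \<Rightarrow> bool" where
  "qmut_step l z \<sigma> N ex s s' \<longleftrightarrow>
     (\<exists>k\<in>ex. \<exists>lam. toric_frame l z \<sigma> N (fst s) lam \<and>
        toric_frame l z \<sigma> N (fst s') (mut_lam N (snd s) k lam) \<and>
        (\<forall>j<N. j \<noteq> k \<longrightarrow> fst s' (ev j) = fst s (ev j)) \<and>
        fst s' (ev k) = fst s (\<lambda>i. - ev k i + colpos N (snd s) k i) + fst s (\<lambda>i. - ev k i - colneg N (snd s) k i) \<and>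
        snd s' = mutB k (snd s))"

definition qmut_equiv where
  "qmut_equiv l z \<sigma> N ex = equivclp (qmut_step l z \<sigma> N ex)"

definition Cring :: "nat \<Rightarrow> complex \<Rightarrow> (complex \<Rightarrow> 'f::division_ring) \<Rightarrow> nat \<Rightarrow> nat set \<Rightarrow> nat set \<Rightarrow>
    ((nat \<Rightarrow> int) \<Rightarrow> 'f) \<Rightarrow> (nat \<Rightarrow> nat \<Rightarrow> int) \<Rightarrow> 'f set" where
  "Cring l z \<sigma> N ex Inv M B = ring_gen
     ({fst s' (ev i) ^ l | s' i. qmut_equiv l z \<sigma> N ex (M, B) s' \<and>
          quantum_seed l z \<sigma> N ex (fst s') (snd s') \<and> i < N} \<union>
      {inverse (fst s' (ev j)) ^ l | s' j. qmut_equiv l z \<sigma> N ex (M, B) s' \<and>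
          quantum_seed l z \<sigma> N ex (fst s') (snd s') \<and> j \<in> Inv})"

type_synonym ratfun = "((nat \<Rightarrow>\<^sub>0 nat) \<Rightarrow>\<^sub>0 int) fract"

definition xvar :: "nat \<Rightarrow> ratfun" where
  "xvar i = Fract (Poly_Mapping.single (Poly_Mapping.single i 1) 1) 1"

definition cmut_step :: "nat \<Rightarrow> nat set \<Rightarrow> (nat \<Rightarrow> ratfun) \<times> (nat \<Rightarrow> nat \<Rightarrow> int) \<Rightarrow>
    (nat \<Rightarrow> ratfun) \<times> (nat \<Rightarrow> nat \<Rightarrow> int) \<Rightarrow> bool" where
  "cmut_step N ex s s' \<longleftrightarrow>
     (\<exists>k\<in>ex. fst s' = (fst s)(k := ((\<Prod>i\<in>{i. i < N \<and> snd s i k > 0}. fst s i ^ nat (snd s i k)) +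
                                    (\<Prod>i\<in>{i. i < N \<and> snd s i k < 0}. fst s i ^ nat (- snd s i k)))
                                   / fst s k) \<and>
        snd s' = mutB k (snd s))"

definition cluster_algebra :: "nat \<Rightarrow> nat set \<Rightarrow> nat set \<Rightarrow> (nat \<Rightarrow> nat \<Rightarrow> int) \<Rightarrow> ratfun set" where
  "cluster_algebra N ex Inv B = ring_gen
     ({fst s' i | s' i. equivclp (cmut_step N ex) (xvar, B) s' \<and> i < N} \<union>
      {inverse (xvar j) | j. j \<in> Inv})"

definition ring_isomorphic :: "'a::ring_1 set \<Rightarrow> 'b::ring_1 set \<Rightarrow> bool" where
  "ring_isomorphic A C \<longleftrightarrow> (\<exists>h. bij_betw h A C \<and> h 1 = 1 \<and>
     (\<forall>a\<in>A. \<forall>b\<in>A. h (a + b) = h a + h b \<and> h (a * b) = h a * h b))"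

end

(*
  For every toric frame M' of F the powers M'(e_i)^l are central, and the M(l f), f in Z^N, are
  linearly independent over Z.  Hence x_i -> M(e_i)^l extends to an embedding Phi of
  Q(x_0, ..., x_(N-1)) into the centre of F.  The two summands A, C of a mutated variable
  satisfy A C = q C A, where q = epsilon^(-d_k) is a primitive l-th root of unity by condition
  (Coprime), so (A + C)^l = A^l + C^l by the quantum binomial formula.  The l-th powers of the
  quantum cluster variables therefore obey the classical exchange relations, and by induction
  along chains of mutations Phi maps the classical cluster variables onto them.  To lift a
  classical chain one needs that the mutation of a toric frame exists; this is where
  linear independence of the mutated frame is proved by grading F by the exponent of e_k.
*)
theory Submission
  imports Defs "HOL-Library.Function_Algebras"
begin

section \<open>Generated subrings and division rings\<close>

text \<open>Both mutation classes are equivalence closures, so a chain may also follow a step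
  backwards. Invariants are therefore passed through a step in both directions, and a backward
  classical step is turned into a forward one, mutation being an involution while no variable
  vanishes. The matrix D is the same in the whole class and carries condition (Coprime) along,
  whereas Lambda changes, is determined by the frame only modulo l, and is hidden in each step by a
  quantifier. A mutated frame is built in two stages: the monomial substitution E, then the
  replacement of M(e_k), in the substituted frame, by the binomial U = M(e_k) + M(e_k + b^k). The
  obstacle is that negative powers of U are not combinations of the old monomials; left
  multiplication by a high power of U removes them. Oddness of l enters twice: it makes Lambda
  alternating modulo l, so that powers of frame elements carry no scalar, and it keeps the square of
  a primitive l-th root of unity primitive.\<close>

lemma ring_gen_0: "0 \<in> ring_gen S"
  using rg_add[OF rg_one rg_neg[OF rg_one], of S] by simp

lemma ring_gen_of_int: "of_int n \<in> ring_gen S"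
proof -
  have nat: "of_nat m \<in> ring_gen S" for m :: nat
    by (induction m) (auto intro: ring_gen_0 rg_add rg_one)
  show ?thesis
    by (cases n) (use nat rg_neg[OF nat] in \<open>auto simp del: of_nat_Suc\<close>)
qed

lemma ring_gen_power: "x \<in> ring_gen S \<Longrightarrow> x ^ n \<in> ring_gen S"
  by (induction n) (auto intro: rg_one rg_mult)

lemma ring_gen_subset_divring_gen: "ring_gen S \<subseteq> divring_gen S"
proof
  show "x \<in> divring_gen S" if "x \<in> ring_gen S" for x
    using that by induction (auto intro: divring_gen.intros)
qed

lemma divring_gen_subset:
  assumes "S \<subseteq> divring_gen T"
  shows "divring_gen S \<subseteq> divring_gen T"
proof
  show "x \<in> divring_gen T" if "x \<in> divring_gen S" for x
    using that by induction (use assms in \<open>auto intro: divring_gen.intros\<close>)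
qed

text \<open>The elements commuting with \<open>y\<close> form a division subring, so generators
  suffice.\<close>

lemma commute_divring_gen:
  assumes "\<And>x. x \<in> S \<Longrightarrow> x * y = y * x" "x \<in> divring_gen S"
  shows "x * y = y * x"
  using assms(2)
proof induction
  case (dg_mult u v)
  then show ?case by (metis mult.assoc)
qed (use assms(1) mult_commute_imp_mult_inverse_commute in \<open>auto simp: algebra_simps\<close>)

section \<open>The quantum binomial formula at a root of unity\<close>

text \<open>The Gaussian binomial coefficient given by its Pascal rule: the usual quotient of
  q-factorials can become 0/0 at a root of unity.\<close>

fun gauss_binomial :: "'a::ring_1 \<Rightarrow> nat \<Rightarrow> nat \<Rightarrow> 'a" where
  "gauss_binomial q n 0 = 1"
| "gauss_binomial q 0 (Suc j) = 0"
| "gauss_binomial q (Suc n) (Suc j) = q ^ Suc j * gauss_binomial q n (Suc j) + gauss_binomial q n j"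

lemma gauss_binomial_eq_0: "n < j \<Longrightarrow> gauss_binomial q n j = 0"
  by (induction q n j rule: gauss_binomial.induct) auto

lemma gauss_binomial_diag: "gauss_binomial q n n = 1"
  by (induction n) (auto simp: gauss_binomial_eq_0)

lemma gauss_binomial_commute:
  assumes "q * y = y * q"
  shows "gauss_binomial q n j * y = y * gauss_binomial q n j"
  using assms
proof (induction q n j rule: gauss_binomial.induct)
  case (3 q n j)
  then have "q ^ Suc j * y = y * q ^ Suc j"
    by (intro power_commuting_commutes)
  then have "q ^ Suc j * gauss_binomial q n (Suc j) * y = y * (q ^ Suc j * gauss_binomial q n (Suc j))"
    using 3 by (metis mult.assoc)
  with 3 show ?case
    by (simp only: gauss_binomial.simps distrib_left distrib_right)
qed auto

text \<open>The quotient rule for neighbouring coefficients with denominators cleared, so that it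
  survives at roots of unity. If \<open>q ^ n = 1\<close>, its right side vanishes at
  \<open>j = 0\<close>.\<close>

lemma gauss_binomial_absorb:
  "j \<le> n \<Longrightarrow> (1 - q ^ Suc j) * gauss_binomial q n (Suc j) = (1 - q ^ (n - j)) * gauss_binomial q n j"
proof (induction n arbitrary: j)
  case (Suc n)
  show ?case
  proof (cases j)
    case 0
    have "(1 - q) * (q * gauss_binomial q n 1 + 1) = q * ((1 - q) * gauss_binomial q n 1) + (1 - q)"
      by (simp add: left_diff_distrib right_diff_distrib distrib_left mult.assoc)
    also have "\<dots> = 1 - q ^ Suc n"
      using Suc.IH[of 0] by (simp add: right_diff_distrib)
    finally show ?thesis
      using 0 by simp
  next
    case (Suc i)
    consider "j = Suc n" | "j \<le> n"
      using Suc.prems by linarith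
    then show ?thesis
    proof cases
      case 1
      then show ?thesis by (simp add: gauss_binomial_eq_0)
    next
      case 2
      let ?g = "gauss_binomial q n"
      have a: "(1 - q ^ Suc j) * ?g (Suc j) = (1 - q ^ (n - j)) * ?g j"
        using Suc.IH 2 by blast
      have b: "(1 - q ^ j) * ?g j = (1 - q ^ (Suc n - j)) * ?g i"
        using Suc.IH[of i] 2 \<open>j = Suc i\<close> by simp
      have c: "(1 - q ^ Suc j) * (q ^ Suc j * ?g (Suc j)) = q ^ Suc j * ((1 - q ^ Suc j) * ?g (Suc j))"
        by (simp only: left_diff_distrib right_diff_distrib mult_1_left mult.assoc)
      have "(1 - q ^ Suc j) * gauss_binomial q (Suc n) (Suc j)
          = q ^ Suc j * ((1 - q ^ (n - j)) * ?g j) + (1 - q ^ Suc j) * ?g j"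
        by (simp only: gauss_binomial.simps distrib_left c a)
      also have "\<dots> = (1 - q ^ Suc n) * ?g j"
      proof -
        have "q ^ Suc j * (q ^ (n - j) * ?g j) = q ^ Suc n * ?g j"
          using 2 by (simp only: mult.assoc[symmetric] power_add[symmetric]) simp
        then show ?thesis
          by (simp only: left_diff_distrib right_diff_distrib mult_1_left) simp
      qed
      also have "\<dots> = (1 - q ^ (Suc n - j)) * (q ^ j * ?g j) + (1 - q ^ j) * ?g j"
      proof -
        have "q ^ (Suc n - j) * (q ^ j * ?g j) = q ^ Suc n * ?g j"
          using 2 by (simp only: mult.assoc[symmetric] power_add[symmetric]) simp
        then show ?thesis
          by (simp only: left_diff_distrib right_diff_distrib mult_1_left) simp
      qed
      also have "\<dots> = (1 - q ^ (Suc n - j)) * gauss_binomial q (Suc n) j"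
        unfolding b using \<open>j = Suc i\<close> by (simp only: gauss_binomial.simps distrib_left)
      finally show ?thesis .
    qed
  qed
qed auto

lemma quantum_binomial:
  fixes q a c :: "'a::ring_1"
  assumes q: "\<And>y. q * y = y * q" and ac: "a * c = q * (c * a)"
  shows "(a + c) ^ n = (\<Sum>j\<le>n. gauss_binomial q n j * (c ^ j * a ^ (n - j)))"
proof (induction n)
  case (Suc n)
  let ?g = "gauss_binomial q n"
  have qp: "q ^ j * y = y * q ^ j" for j y
    using q by (intro power_commuting_commutes)
  \<comment> \<open>Passing \<open>a\<close> through \<open>c ^ j\<close> yields exactly the power
    of \<open>q\<close> in the Pascal rule.\<close>
  have acj: "a * c ^ j = q ^ j * (c ^ j * a)" for j
  proof (induction j)
    case (Suc j)
    have "a * c ^ Suc j = q * (c * (a * c ^ j))"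
      by (simp add: ac mult.assoc[symmetric])
    also have "\<dots> = q * (q ^ j * (c * (c ^ j * a)))"
      by (metis Suc mult.assoc qp)
    finally show ?case
      by (simp add: mult.assoc)
  qed simp
  have "(a + c) ^ Suc n = (\<Sum>j\<le>n. (a + c) * (?g j * (c ^ j * a ^ (n - j))))"
    by (simp add: Suc sum_distrib_left)
  also have "\<dots> = (\<Sum>j\<le>n. (q ^ j * ?g j) * (c ^ j * a ^ (Suc n - j)) + ?g j * (c ^ Suc j * a ^ (n - j)))"
  proof (rule sum.cong[OF refl])
    fix j assume "j \<in> {..n}"
    then have j: "Suc n - j = Suc (n - j)" by auto
    have g: "?g j * y = y * ?g j" for y
      using gauss_binomial_commute[OF q] .
    have "a * (?g j * (c ^ j * a ^ (n - j))) = ?g j * ((a * c ^ j) * a ^ (n - j))"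
      by (simp only: mult.assoc[symmetric] g[of a, symmetric])
    also have "\<dots> = (?g j * q ^ j) * (c ^ j * a ^ (Suc n - j))"
      by (simp add: acj mult.assoc j)
    finally have "a * (?g j * (c ^ j * a ^ (n - j))) = (q ^ j * ?g j) * (c ^ j * a ^ (Suc n - j))"
      by (simp only: g[of "q ^ j"])
    moreover have "c * (?g j * (c ^ j * a ^ (n - j))) = ?g j * (c ^ Suc j * a ^ (n - j))"
      by (simp only: mult.assoc[symmetric] g[of c, symmetric] power_Suc)
    ultimately show "(a + c) * (?g j * (c ^ j * a ^ (n - j)))
        = (q ^ j * ?g j) * (c ^ j * a ^ (Suc n - j)) + ?g j * (c ^ Suc j * a ^ (n - j))"
      by (simp only: distrib_right)
  qed
  also have "\<dots> = (\<Sum>j\<le>n. (q ^ j * ?g j) * (c ^ j * a ^ (Suc n - j)))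
      + (\<Sum>j\<le>n. ?g j * (c ^ Suc j * a ^ (n - j)))"
    by (rule sum.distrib)
  \<comment> \<open>The extra term is zero; it aligns the range with that of the second sum after
    the index shift.\<close>
  also have "(\<Sum>j\<le>n. (q ^ j * ?g j) * (c ^ j * a ^ (Suc n - j)))
      = (\<Sum>j\<le>Suc n. (q ^ j * ?g j) * (c ^ j * a ^ (Suc n - j)))"
    by (simp add: gauss_binomial_eq_0)
  also have "\<dots> = a ^ Suc n + (\<Sum>j\<le>n. (q ^ Suc j * ?g (Suc j)) * (c ^ Suc j * a ^ (n - j)))"
    by (subst sum.atMost_Suc_shift) simp
  also have "\<dots> + (\<Sum>j\<le>n. ?g j * (c ^ Suc j * a ^ (n - j)))
      = a ^ Suc n + (\<Sum>j\<le>n. gauss_binomial q (Suc n) (Suc j) * (c ^ Suc j * a ^ (n - j)))"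
    by (simp only: add.assoc sum.distrib[symmetric] gauss_binomial.simps distrib_right)
  also have "\<dots> = (\<Sum>j\<le>Suc n. gauss_binomial q (Suc n) j * (c ^ j * a ^ (Suc n - j)))"
    by (subst sum.atMost_Suc_shift) simp
  finally show ?case .
qed simp

text \<open>Starting from \<open>1 - q ^ l = 0\<close>, the quotient rule makes the inner
  coefficients vanish one after another, because the factors \<open>1 - q ^ m\<close> with
  \<open>0 < m < l\<close> are nonzero and can be cancelled.\<close>

lemma quantum_frobenius:
  fixes q a c :: "'a::division_ring"
  assumes q: "\<And>y. q * y = y * q" and ac: "a * c = q * (c * a)"
    and "0 < l" "q ^ l = 1" "\<And>m. 0 < m \<Longrightarrow> m < l \<Longrightarrow> q ^ m \<noteq> 1"
  shows "(a + c) ^ l = a ^ l + c ^ l"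
proof -
  have 0: "Suc j < l \<Longrightarrow> gauss_binomial q l (Suc j) = 0" for j
  proof (induction j)
    case 0
    then show ?case
      using gauss_binomial_absorb[of 0 l q] assms(4) assms(5)[of 1] by auto
  next
    case (Suc j)
    then show ?case
      using gauss_binomial_absorb[of "Suc j" l q] assms(5)[of "Suc (Suc j)"] by auto
  qed
  obtain n where n: "l = Suc n"
    using \<open>0 < l\<close> gr0_conv_Suc by auto
  have "(a + c) ^ l = (\<Sum>j\<le>Suc n. gauss_binomial q l j * (c ^ j * a ^ (l - j)))"
    using quantum_binomial[OF q ac] n by blast
  also have "\<dots> = a ^ l + (\<Sum>j\<le>n. gauss_binomial q l (Suc j) * (c ^ Suc j * a ^ (l - Suc j)))"
    by (subst sum.atMost_Suc_shift) simp
  also have "(\<Sum>j\<le>n. gauss_binomial q l (Suc j) * (c ^ Suc j * a ^ (l - Suc j)))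
      = (\<Sum>j\<in>{n}. gauss_binomial q l (Suc j) * (c ^ Suc j * a ^ (l - Suc j)))"
    by (rule sum.mono_neutral_right) (use 0 n in auto)
  also have "\<dots> = c ^ l"
    using n by (simp add: gauss_binomial_diag del: gauss_binomial.simps power_Suc)
  finally show ?thesis .
qed

section \<open>Bilinear forms and scalars\<close>

lemma bform_add_left: "bform N lam (f + g) h = bform N lam f h + bform N lam g h"
  and bform_add_right: "bform N lam f (g + h) = bform N lam f g + bform N lam f h"
  by (simp_all add: bform_def sum.distrib algebra_simps)

lemma bform_minus_left: "bform N lam (- f) h = - bform N lam f h"
  and bform_minus_right: "bform N lam f (- h) = - bform N lam f h"
  by (simp_all add: bform_def sum_negf)

lemma bform_0_left [simp]: "bform N lam 0 h = 0"
  and bform_0_right [simp]: "bform N lam f 0 = 0"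
  by (simp_all add: bform_def)

definition scale :: "int \<Rightarrow> (nat \<Rightarrow> int) \<Rightarrow> nat \<Rightarrow> int" where
  "scale n f = (\<lambda>i. n * f i)"

lemma scale_apply: "scale n f i = n * f i"
  by (simp add: scale_def)

lemma scale_0 [simp]: "scale 0 f = 0"
  and scale_zero [simp]: "scale n 0 = 0"
  and scale_add_right: "scale m (f + g) = scale m f + scale m g"
  by (auto simp: fun_eq_iff scale_apply algebra_simps)

lemma bform_scale_left: "bform N lam (scale n f) h = n * bform N lam f h"
  and bform_scale_right: "bform N lam f (scale n h) = n * bform N lam f h"
  by (simp_all add: bform_def scale_apply sum_distrib_left algebra_simps)

lemma ev_apply: "ev i j = (if j = i then 1 else 0)"
  by (simp add: ev_def)

lemma bform_expand_right: "bform N lam f g = (\<Sum>j<N. bform N lam f (ev j) * g j)"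
proof -
  have "bform N lam f (ev j) = (\<Sum>i<N. f i * lam i j)" if "j < N" for j
    using that by (simp add: bform_def ev_apply if_distrib[of "\<lambda>x. _ * x"] cong: if_cong)
  then show ?thesis
    by (simp add: bform_def sum_distrib_right) (rule sum.swap)
qed

lemma bform_ev: "i < N \<Longrightarrow> j < N \<Longrightarrow> bform N lam (ev i) (ev j) = lam i j"
  by (simp add: bform_def ev_apply if_distrib[of "\<lambda>x. _ * x"] if_distrib[of "\<lambda>x. x * _"] cong: if_cong)

lemma ZN_0 [simp]: "0 \<in> ZN N"
  and ZN_add [intro]: "f \<in> ZN N \<Longrightarrow> g \<in> ZN N \<Longrightarrow> f + g \<in> ZN N"
  and ZN_minus [intro]: "f \<in> ZN N \<Longrightarrow> - f \<in> ZN N"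
  and ZN_diff [intro]: "f \<in> ZN N \<Longrightarrow> g \<in> ZN N \<Longrightarrow> f - g \<in> ZN N"
  and ZN_scale [intro]: "f \<in> ZN N \<Longrightarrow> scale n f \<in> ZN N"
  and ZN_ev [intro]: "i < N \<Longrightarrow> ev i \<in> ZN N"
  and ZN_upd [intro]: "f \<in> ZN N \<Longrightarrow> i < N \<Longrightarrow> f(i := x) \<in> ZN N"
  by (auto simp: ZN_def ev_apply scale_apply)

section \<open>Powers of the root of unity as central scalars\<close>

locale root_of_unity =
  fixes l :: nat and z :: complex and \<sigma> :: "complex \<Rightarrow> 'f::division_ring"
  assumes l_pos: "0 < l" and l_odd: "odd l"
    and prim: "primitive_root l z" and alg: "Qz_algebra z \<sigma>"
begin

lemma z_pow_l: "z ^ l = 1"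
  using prim by (simp add: primitive_root_def)

lemma z_nonzero: "z \<noteq> 0"
  using z_pow_l l_pos by (auto simp: power_0_left)

lemma zpow_eq: "zpow l z a = z powi a"
proof -
  have "z powi a = z powi (int l * (a div int l) + a mod int l)"
    by simp
  also have "\<dots> = (z powi int l) powi (a div int l) * z powi (a mod int l)"
    using z_nonzero by (simp only: power_int_add power_int_mult simp_thms)
  also have "\<dots> = z powi (a mod int l)"
    by (simp add: z_pow_l)
  also have "\<dots> = zpow l z a"
    using l_pos by (simp add: zpow_def power_int_def)
  finally show ?thesis ..
qed

lemma zpow_eq_1_iff: "zpow l z a = 1 \<longleftrightarrow> int l dvd a"
proof
  assume "zpow l z a = 1"
  moreover have "nat (a mod int l) < l"
    using l_pos by (simp add: nat_less_iff)
  ultimately have "nat (a mod int l) = 0"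
    using prim unfolding zpow_def primitive_root_def by (metis neq0_conv)
  then show "int l dvd a"
    using l_pos by (metis Euclidean_Rings.pos_mod_sign dvd_eq_mod_eq_0 nat_0_iff of_nat_0_less_iff order_antisym)
qed (auto simp: zpow_def)

lemma zpow_Zz: "zpow l z a \<in> Zz z"
  by (auto simp: zpow_def intro: ring_gen_power rg_base)

lemma Zz_Qz: "x \<in> Zz z \<Longrightarrow> x \<in> Qz z"
  using ring_gen_subset_divring_gen by blast

lemma \<sigma>_1 [simp]: "\<sigma> 1 = 1"
  using alg by (simp add: Qz_algebra_def)

lemma \<sigma>_add: "a \<in> Qz z \<Longrightarrow> b \<in> Qz z \<Longrightarrow> \<sigma> (a + b) = \<sigma> a + \<sigma> b"
  and \<sigma>_mult: "a \<in> Qz z \<Longrightarrow> b \<in> Qz z \<Longrightarrow> \<sigma> (a * b) = \<sigma> a * \<sigma> b"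
  and \<sigma>_commute: "a \<in> Qz z \<Longrightarrow> \<sigma> a * y = y * \<sigma> a"
  using alg unfolding Qz_algebra_def by blast+

lemma Qz_0: "0 \<in> Qz z"
  by (rule Zz_Qz[OF ring_gen_0])

lemma \<sigma>_0 [simp]: "\<sigma> 0 = 0"
  using \<sigma>_add[OF Qz_0 Qz_0] by simp

lemma \<sigma>_minus: "a \<in> Qz z \<Longrightarrow> \<sigma> (- a) = - \<sigma> a"
  using \<sigma>_add[of a "- a"] by (simp add: dg_neg eq_neg_iff_add_eq_0 add.commute)

lemma \<sigma>_of_int: "\<sigma> (of_int n) = of_int n"
proof -
  have nat: "\<sigma> (of_nat m) = of_nat m" for m
  proof (induction m)
    case (Suc m)
    have "of_nat m \<in> Qz z"
      using Zz_Qz[OF ring_gen_of_int[of "int m"]] by simp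
    then show ?case
      using Suc by (simp add: \<sigma>_add dg_one)
  qed simp
  have q: "of_nat m \<in> Qz z" for m
    using Zz_Qz[OF ring_gen_of_int[of "int m"]] by simp
  show ?thesis
    by (cases n) (use nat \<sigma>_minus[OF q] in \<open>auto simp del: of_nat_Suc\<close>)
qed

text \<open>A ring map out of the field Q(zeta) is injective; this carries the order of the root of
  unity and characteristic 0 over to F.\<close>

lemma \<sigma>_eq_0_iff: "a \<in> Qz z \<Longrightarrow> \<sigma> a = 0 \<longleftrightarrow> a = 0"
  using \<sigma>_mult[of a "inverse a"] by (cases "a = 0") (auto simp: dg_inv)

text \<open>The central scalar eps^(a/2) of F.\<close>

definition s :: "int \<Rightarrow> 'f" where
  "s a = \<sigma> (zpow l z a)"

lemma s_commute: "s a * y = y * s a"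
  unfolding s_def by (intro \<sigma>_commute zpow_Zz Zz_Qz)

lemma s_mult: "s a * s b = s (a + b)"
  unfolding s_def
  by (subst \<sigma>_mult[symmetric]) (auto simp: zpow_Zz Zz_Qz, simp add: zpow_eq power_int_add z_nonzero)

lemma s_mult_left: "s a * (s b * y) = s (a + b) * y"
  by (simp add: mult.assoc[symmetric] s_mult)

lemma s_eq_1_iff: "s a = 1 \<longleftrightarrow> int l dvd a"
proof -
  have "s a = 1 \<longleftrightarrow> \<sigma> (zpow l z a + (- 1)) = 0"
    by (subst \<sigma>_add) (auto simp: zpow_Zz Zz_Qz dg_neg dg_one \<sigma>_minus s_def)
  also have "\<dots> \<longleftrightarrow> zpow l z a = 1"
    by (subst \<sigma>_eq_0_iff) (intro dg_add dg_neg dg_one Zz_Qz zpow_Zz, simp)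
  finally show ?thesis
    by (simp add: zpow_eq_1_iff)
qed

lemma s_0 [simp]: "s 0 = 1"
  by (simp add: s_eq_1_iff)

lemma s_nonzero [simp]: "s a \<noteq> 0"
  using s_mult[of a "- a"] by auto

lemma s_cong: "int l dvd a - b \<Longrightarrow> s a = s b"
  using s_mult[of "a - b" b] s_eq_1_iff[of "a - b"] by simp

lemma s_eq_iff: "s a = s b \<longleftrightarrow> int l dvd a - b"
proof
  assume "s a = s b"
  then have "s (a - b) = 1"
    using s_mult[of a "- b"] s_mult[of b "- b"] by simp
  then show "int l dvd a - b"
    by (simp add: s_eq_1_iff)
qed (rule s_cong)

lemma s_power: "s a ^ n = s (int n * a)"
  by (induction n) (auto simp: s_mult algebra_simps)

lemma s_Zz: "s a \<in> \<sigma> ` Zz z"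
  unfolding s_def using zpow_Zz by blast

text \<open>For a negative exponent, the relation for the positive power is multiplied on both sides
  by the inverse of that power.\<close>

lemma commute_power_int:
  assumes "u \<noteq> 0" and xu: "x * u = s c * (u * x)"
  shows "x * u powi n = s (n * c) * (u powi n * x)"
proof -
  have nat: "x * u ^ m = s (int m * c) * (u ^ m * x)" for m
  proof (induction m)
    case (Suc m)
    have "x * u ^ Suc m = (x * u) * u ^ m"
      by (simp add: mult.assoc)
    also have "\<dots> = s c * (u * (x * u ^ m))"
      by (simp only: xu mult.assoc)
    also have "\<dots> = s c * (s (int m * c) * (u * (u ^ m * x)))"
      using s_commute[of "int m * c" u] by (simp only: Suc mult.assoc[symmetric])
    finally show ?case
      by (simp add: s_mult_left mult.assoc algebra_simps)
  qed simp
  show ?thesis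
  proof (cases n)
    case (nonneg m)
    then show ?thesis by (simp add: nat)
  next
    case (neg m)
    let ?v = "u ^ Suc m"
    have n: "n = - int (Suc m)"
      using neg by simp
    have v: "?v \<noteq> 0"
      using \<open>u \<noteq> 0\<close> by simp
    have "inverse ?v * (x * ?v) * inverse ?v = inverse ?v * (s (int (Suc m) * c) * (?v * x)) * inverse ?v"
      by (simp only: nat)
    also have "\<dots> = s (int (Suc m) * c) * (inverse ?v * ?v) * x * inverse ?v"
      using s_commute[of "int (Suc m) * c" "inverse ?v"] by (simp only: mult.assoc[symmetric])
    also have "\<dots> = s (int (Suc m) * c) * (x * inverse ?v)"
      unfolding left_inverse[OF v] by (simp only: mult_1_right mult.assoc)
    also have "inverse ?v * (x * ?v) * inverse ?v = inverse ?v * x * (?v * inverse ?v)"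
      by (simp only: mult.assoc)
    also have "\<dots> = inverse ?v * x"
      unfolding right_inverse[OF v] by simp
    finally have "s (n * c) * (inverse ?v * x) = s (n * c) * (s (int (Suc m) * c) * (x * inverse ?v))"
      by simp
    also have "\<dots> = x * inverse ?v"
      by (simp add: s_mult_left n del: power_Suc of_nat_Suc)
    finally show ?thesis
      by (simp only: n power_int_minus power_int_of_nat)
  qed
qed

end

section \<open>Toric frames\<close>

locale frame = root_of_unity l z \<sigma>
  for l :: nat and z :: complex and \<sigma> :: "complex \<Rightarrow> 'f::division_ring" +
  fixes N :: nat and M :: "(nat \<Rightarrow> int) \<Rightarrow> 'f" and lam :: "nat \<Rightarrow> nat \<Rightarrow> int"
  assumes toric: "toric_frame l z \<sigma> N M lam"
begin

abbreviation Lam :: "(nat \<Rightarrow> int) \<Rightarrow> (nat \<Rightarrow> int) \<Rightarrow> int" where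
  "Lam \<equiv> bform N lam"

lemma M_0 [simp]: "M 0 = 1"
  using toric by (simp add: toric_frame_def zero_fun_def)

lemma M_mult: "f \<in> ZN N \<Longrightarrow> g \<in> ZN N \<Longrightarrow> M f * M g = s (Lam f g) * M (f + g)"
  using toric by (simp add: toric_frame_def plus_fun_def s_def)

lemma M_generate: "divring_gen (M ` ZN N \<union> \<sigma> ` Zz z) = UNIV"
  using toric by (simp add: toric_frame_def)

text \<open>The independence axiom for indexed families; later relations are indexed by polynomial
  monomials or by pairs, not by exponent vectors.\<close>

lemma M_independent:
  assumes "finite I" "h ` I \<subseteq> ZN N" "inj_on h I" "\<And>i. i \<in> I \<Longrightarrow> c i \<in> Zz z"
    and "(\<Sum>i\<in>I. \<sigma> (c i) * M (h i)) = 0" "i \<in> I"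
  shows "c i = 0"
proof -
  define c' where "c' = c \<circ> the_inv_into I h"
  have c': "c' (h j) = c j" if "j \<in> I" for j
    using that assms(3) by (simp add: c'_def the_inv_into_f_f)
  have "(\<Sum>f\<in>h ` I. \<sigma> (c' f) * M f) = (\<Sum>i\<in>I. \<sigma> (c i) * M (h i))"
    using assms(3) by (simp add: sum.reindex c')
  then have "finite (h ` I) \<and> h ` I \<subseteq> ZN N \<and> (\<forall>f\<in>h ` I. c' f \<in> Zz z) \<and> (\<Sum>f\<in>h ` I. \<sigma> (c' f) * M f) = 0"
    using assms c' by auto
  moreover have "finite S \<and> S \<subseteq> ZN N \<and> (\<forall>f\<in>S. c f \<in> Zz z) \<and> (\<Sum>f\<in>S. \<sigma> (c f) * M f) = 0
      \<longrightarrow> (\<forall>f\<in>S. c f = 0)" for S c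
    using toric unfolding toric_frame_def by blast
  ultimately have "\<forall>f\<in>h ` I. c' f = 0"
    by blast
  then show ?thesis
    using assms(6) c' by auto
qed

lemma Lam_skew: "int l dvd Lam f g + Lam g f"
proof -
  have "Lam g f = (\<Sum>i<N. \<Sum>j<N. f i * lam j i * g j)"
    unfolding bform_def by (subst sum.swap) (simp add: mult.commute mult.left_commute)
  then have "Lam f g + Lam g f = (\<Sum>i<N. \<Sum>j<N. f i * (lam i j + lam j i) * g j)"
    by (simp add: bform_def sum.distrib algebra_simps)
  also have "int l dvd \<dots>"
    using toric by (intro dvd_sum) (auto simp: toric_frame_def skew_mod_def mod_eq_0_iff_dvd intro!: dvd_mult2 dvd_mult)
  finally show ?thesis .
qed

text \<open>Skewness yields only that l divides \<open>2 * Lam f f\<close>; oddness of l removes the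
  factor 2.\<close>

lemma Lam_self: "int l dvd Lam f f"
proof -
  have "int l dvd 2 * Lam f f"
    using Lam_skew[of f f] by simp
  moreover have "coprime (int l) 2"
    using l_odd by simp
  ultimately show ?thesis
    by (simp add: coprime_dvd_mult_right_iff)
qed

lemma M_nonzero: "f \<in> ZN N \<Longrightarrow> M f \<noteq> 0"
  using M_independent[of "{()}" "\<lambda>_. f" "\<lambda>_. 1"] by (auto simp: rg_one)

text \<open>Modulo l, the exponent \<open>Lam f g - Lam g f\<close> picked up on exchanging the
  factors is \<open>2 * Lam f g\<close>.\<close>

lemma M_commute:
  assumes "f \<in> ZN N" "g \<in> ZN N"
  shows "M f * M g = s (2 * Lam f g) * (M g * M f)"
proof -
  have "s (Lam f g) = s (2 * Lam f g + Lam g f)"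
    using Lam_skew[of f g] dvd_minus_iff by (intro s_cong) (fastforce simp: algebra_simps)
  then show ?thesis
    using assms by (simp add: M_mult s_mult_left add.commute)
qed

lemma M_minus:
  assumes "f \<in> ZN N"
  shows "inverse (M f) = M (- f)"
proof -
  have "M f * M (- f) = 1"
    using assms by (subst M_mult) (auto simp: bform_minus_right s_eq_1_iff Lam_self)
  then show ?thesis
    by (rule inverse_unique)
qed

lemma M_power:
  assumes "f \<in> ZN N"
  shows "M f ^ n = M (scale (int n) f)"
proof (induction n)
  case (Suc n)
  have "M f ^ Suc n = M f * M (scale (int n) f)"
    by (simp only: Suc power_Suc)
  also have "\<dots> = M (f + scale (int n) f)"
    using assms Lam_self[of f] s_eq_1_iff[of "int n * Lam f f"]
    by (subst M_mult) (auto simp: bform_scale_right)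
  also have "f + scale (int n) f = scale (int (Suc n)) f"
    by (simp add: fun_eq_iff scale_apply algebra_simps)
  finally show ?case .
next
  case 0
  show ?case
    by (simp only: power_0 of_nat_0 scale_0 M_0)
qed

lemma M_power_int:
  assumes "f \<in> ZN N"
  shows "M f powi n = M (scale n f)"
proof (cases "n \<ge> 0")
  case True
  then show ?thesis using assms by (simp add: power_int_def M_power)
next
  case False
  then show ?thesis
    using assms by (simp add: power_int_def M_power M_minus power_inverse[symmetric] ZN_minus)
     (auto simp: fun_eq_iff scale_apply intro!: arg_cong[of _ _ M])
qed

lemma M_scale_l_mult:
  assumes "f \<in> ZN N" "g \<in> ZN N"
  shows "M (scale (int l) f) * M g = M (scale (int l) f + g)"
  using assms by (subst M_mult) (auto simp: bform_scale_left s_eq_1_iff)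

text \<open>Pairing with l f is zero modulo l, so this element commutes with all generators of
  F.\<close>

lemma M_scale_l_central:
  assumes "f \<in> ZN N"
  shows "M (scale (int l) f) * y = y * M (scale (int l) f)"
proof -
  have "x * M (scale (int l) f) = M (scale (int l) f) * x" if "x \<in> M ` ZN N \<union> \<sigma> ` Zz z" for x
    using that
  proof
    assume "x \<in> M ` ZN N"
    then obtain g where g: "g \<in> ZN N" "x = M g"
      by blast
    have "s (2 * Lam g (scale (int l) f)) = 1"
      by (simp add: bform_scale_right s_eq_1_iff)
    then show ?thesis
      using M_commute[OF g(1) ZN_scale[OF assms]] g(2) by simp
  next
    assume "x \<in> \<sigma> ` Zz z"
    then show ?thesis
      using \<sigma>_commute Zz_Qz by blast
  qed
  then have "y * M (scale (int l) f) = M (scale (int l) f) * y"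
    by (rule commute_divring_gen[where S = "M ` ZN N \<union> \<sigma> ` Zz z"]) (simp_all only: M_generate UNIV_I)
  then show ?thesis ..
qed

lemma M_power_l_central: "f \<in> ZN N \<Longrightarrow> M f ^ l * y = y * M f ^ l"
  by (metis M_power M_scale_l_central)

text \<open>Both matrices give the scalar in \<open>M (ev i) * M (ev j)\<close>, and as z is
  primitive this scalar determines its exponent modulo l.\<close>

lemma lam_unique:
  assumes "toric_frame l z \<sigma> N M lam'" "i < N" "j < N"
  shows "int l dvd lam i j - lam' i j"
proof -
  interpret F': frame l z \<sigma> N M lam'
    by unfold_locales fact
  have "s (Lam (ev i) (ev j)) * M (ev i + ev j) = s (bform N lam' (ev i) (ev j)) * M (ev i + ev j)"
    using M_mult[of "ev i" "ev j"] F'.M_mult[of "ev i" "ev j"] assms by (metis ZN_ev)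
  moreover have "M (ev i + ev j) \<noteq> 0"
    using assms by (intro M_nonzero) auto
  ultimately have "s (Lam (ev i) (ev j)) = s (bform N lam' (ev i) (ev j))"
    using mult_right_cancel by blast
  then show ?thesis
    using assms by (simp add: bform_ev s_eq_iff)
qed

end

section \<open>Exchanging one generator of a toric frame\<close>

context root_of_unity begin

lemma s_left_commute: "y * (s a * x) = s a * (y * x)"
  by (metis mult.assoc s_commute)

lemma divring_gen_power_int: "x \<in> divring_gen S \<Longrightarrow> x powi n \<in> divring_gen S"
proof -
  assume x: "x \<in> divring_gen S"
  have "y ^ m \<in> divring_gen S" if "y \<in> divring_gen S" for y m
    using that by (induction m) (auto intro: dg_one dg_mult)
  then show ?thesis
    using x by (auto simp: power_int_def intro: dg_inv)
qed

end

section \<open>The grading by the exponent of e_k\<close>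

context frame begin

text \<open>The homogeneous part of degree \<open>m\<close> when \<open>M f\<close> has degree
  \<open>f k\<close>, as a Z[zeta]-span. Exponents may repeat, which makes left multiplication by
  \<open>U\<close> an easy induction.\<close>

inductive_set level :: "nat \<Rightarrow> int \<Rightarrow> 'f set" for k m where
  level_0: "0 \<in> level k m"
| level_add: "c \<in> Zz z \<Longrightarrow> f \<in> ZN N \<Longrightarrow> f k = m \<Longrightarrow> x \<in> level k m \<Longrightarrow> \<sigma> c * M f + x \<in> level k m"

lemma level_sum:
  assumes "finite I" "\<And>i. i \<in> I \<Longrightarrow> c i \<in> Zz z \<and> h i \<in> ZN N \<and> h i k = m"
  shows "(\<Sum>i\<in>I. \<sigma> (c i) * M (h i)) \<in> level k m"
  using assms by (induction I) (auto intro: level_0 level_add)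

text \<open>Terms with equal exponents are merged, since independence speaks about distinct
  exponents.\<close>

lemma level_expand:
  assumes "x \<in> level k m"
  obtains S c where "finite S" "S \<subseteq> ZN N" "\<And>f. f \<in> S \<Longrightarrow> f k = m" "\<And>f. c f \<in> Zz z"
    "x = (\<Sum>f\<in>S. \<sigma> (c f) * M f)"
proof -
  have "\<exists>S c. finite S \<and> S \<subseteq> ZN N \<and> (\<forall>f\<in>S. f k = m) \<and> (\<forall>f. c f \<in> Zz z) \<and> x = (\<Sum>f\<in>S. \<sigma> (c f) * M f)"
    using assms
  proof induction
    case level_0
    show ?case
      by (rule exI[of _ "{}"], rule exI[of _ "\<lambda>_. 0"]) (auto intro: ring_gen_0)
  next
    case (level_add d g x)
    then obtain S c where Sc: "finite S" "S \<subseteq> ZN N" "\<forall>f\<in>S. f k = m" "\<forall>f. c f \<in> Zz z"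
      "x = (\<Sum>f\<in>S. \<sigma> (c f) * M f)"
      by blast
    show ?case
    proof (cases "g \<in> S")
      case True
      have "\<sigma> d * M g + x = \<sigma> d * M g + \<sigma> (c g) * M g + (\<Sum>f\<in>S - {g}. \<sigma> (c f) * M f)"
        using Sc True by (simp add: sum.remove add.assoc)
      also have "\<dots> = \<sigma> (d + c g) * M g + (\<Sum>f\<in>S - {g}. \<sigma> (c f) * M f)"
        using Sc level_add by (simp add: \<sigma>_add Zz_Qz algebra_simps)
      also have "\<dots> = (\<Sum>f\<in>S. \<sigma> ((c(g := d + c g)) f) * M f)"
        using Sc True by (simp add: sum.remove)
      finally show ?thesis
        using Sc level_add by (intro exI[of _ S] exI[of _ "c(g := d + c g)"]) (auto intro: rg_add)
    next
      case False
      have "x = (\<Sum>f\<in>S. \<sigma> ((c(g := d)) f) * M f)"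
        unfolding Sc(5) using False by (intro sum.cong) auto
      then show ?thesis
        using Sc(1-4) level_add False by (intro exI[of _ "insert g S"] exI[of _ "c(g := d)"]) auto
    qed
  qed
  then show ?thesis
    using that by blast
qed

text \<open>The degree is a coordinate of the exponent, so expansions of different degrees share no
  monomial and combine to one relation, indexed by pairs (degree, exponent).\<close>

lemma level_independent:
  assumes "finite K" "\<And>m. m \<in> K \<Longrightarrow> x m \<in> level k m" "(\<Sum>m\<in>K. x m) = 0" "m \<in> K"
  shows "x m = 0"
proof -
  have "\<exists>S c. finite S \<and> S \<subseteq> ZN N \<and> (\<forall>f\<in>S. f k = m) \<and> (\<forall>f. c f \<in> Zz z) \<and> x m = (\<Sum>f\<in>S. \<sigma> (c f) * M f)"
    if "m \<in> K" for m
    using level_expand[OF assms(2)[OF that]] by metis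
  then obtain S c where Sc: "\<And>m. m \<in> K \<Longrightarrow> finite (S m) \<and> S m \<subseteq> ZN N \<and> (\<forall>f\<in>S m. f k = m)
      \<and> (\<forall>f. c m f \<in> Zz z) \<and> x m = (\<Sum>f\<in>S m. \<sigma> (c m f) * M f)"
    by metis
  have "(\<Sum>(m, f)\<in>Sigma K S. \<sigma> (c m f) * M f) = 0"
    using Sc assms(1,3) by (subst sum.Sigma[symmetric]) auto
  then have sum0: "(\<Sum>p\<in>Sigma K S. \<sigma> (c (fst p) (snd p)) * M (snd p)) = 0"
    by (simp add: case_prod_beta)
  have fst: "fst p = snd p k" if "p \<in> Sigma K S" for p
    using that Sc by fastforce
  have "c m f = 0" if "f \<in> S m" for f
  proof -
    have "c (fst (m, f)) (snd (m, f)) = 0"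
    proof (rule M_independent[OF _ _ _ _ sum0])
      show "inj_on snd (Sigma K S)"
        by (rule inj_onI) (metis fst prod_eqI)
      show "snd ` Sigma K S \<subseteq> ZN N"
        using Sc by fastforce
    qed (use Sc that assms(1,4) in auto)
    then show ?thesis
      by simp
  qed
  then show ?thesis
    using Sc assms(4) by auto
qed

end

text \<open>The non-monomial stage of a mutation, in which \<open>M (ev k)\<close> gives way to
  \<open>U\<close>. Orthogonality of \<open>b\<close> to the other basis vectors gives both summands
  of \<open>U\<close> the same commutation scalars with the remaining generators.\<close>

locale exchange = frame l z \<sigma> N M lam
  for l :: nat and z :: complex and \<sigma> :: "complex \<Rightarrow> 'f::division_ring"
    and N :: nat and M :: "(nat \<Rightarrow> int) \<Rightarrow> 'f" and lam :: "nat \<Rightarrow> nat \<Rightarrow> int" +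
  fixes k :: nat and b :: "nat \<Rightarrow> int"
  assumes k: "k < N" and b: "b \<in> ZN N" and bk: "b k = 0"
    and Lam_b: "\<And>j. j < N \<Longrightarrow> j \<noteq> k \<Longrightarrow> int l dvd Lam b (ev j)"
begin

lemma Lam_b_eq_0:
  assumes "g k = 0"
  shows "int l dvd Lam b g"
  unfolding bform_expand_right[of N lam b g]
  by (rule dvd_sum) (use assms Lam_b in \<open>metis dvd_0_right dvd_mult2 lessThan_iff mult_zero_right\<close>)

definition U :: 'f where
  "U = M (ev k) + M (ev k + b)"

lemma ek: "ev k \<in> ZN N" and ekb: "ev k + b \<in> ZN N"
  using k b by auto

lemma M_commute_U:
  assumes "g \<in> ZN N" "g k = 0"
  shows "M g * U = s (2 * Lam g (ev k)) * (U * M g)"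
proof -
  have "int l dvd Lam g b"
    using Lam_b_eq_0[of g] assms Lam_skew[of b g] dvd_add_right_iff by blast
  then have "s (2 * Lam g (ev k + b)) = s (2 * Lam g (ev k))"
    by (intro s_cong) (auto simp: bform_add_right)
  then show ?thesis
    using M_commute[OF assms(1) ek] M_commute[OF assms(1) ekb]
    by (simp add: U_def distrib_left distrib_right)
qed

text \<open>For \<open>b = 0\<close> the element is \<open>2 * M (ev k)\<close> and characteristic 0
  helps; otherwise the two exponents differ and independence applies.\<close>

lemma U_nonzero: "U \<noteq> 0"
proof (cases "b = 0")
  case True
  then have "U = \<sigma> (of_int 2) * M (ev k)"
    using U_def unfolding \<sigma>_of_int by (simp add: mult_2)
  moreover have "\<sigma> (of_int 2) \<noteq> 0"
    by (subst \<sigma>_eq_0_iff) (auto intro!: Zz_Qz ring_gen_of_int simp del: of_int_numeral)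
  ultimately show ?thesis
    using M_nonzero[OF ek] by simp
next
  case False
  show ?thesis
  proof
    assume "U = 0"
    then have "(\<Sum>i\<in>{ev k, ev k + b}. \<sigma> 1 * M i) = 0"
      using False by (simp add: U_def)
    from M_independent[OF _ _ _ _ this, of "ev k"] ek ekb show False
      by (auto simp: rg_one)
  qed
qed

lemma M_commute_U_power:
  assumes "g \<in> ZN N" "g k = 0"
  shows "M g * U powi n = s (n * (2 * Lam g (ev k))) * (U powi n * M g)"
  by (rule commute_power_int[OF U_nonzero M_commute_U[OF assms]])

text \<open>Forced by \<open>M' (ev k) = U\<close>, by \<open>M' = M\<close> on exponents with k-th
  entry 0, and by the product rule: the scalar undoes the one from multiplying the two parts of
  \<open>f\<close>.\<close>

definition M' :: "(nat \<Rightarrow> int) \<Rightarrow> 'f" where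
  "M' f = s (- (f k * Lam (ev k) (f(k := 0)))) * (U powi (f k) * M (f(k := 0)))"

lemma M'_eq_M: "f k = 0 \<Longrightarrow> M' f = M f"
  by (simp add: M'_def fun_upd_idem)

lemma ev_upd: "(ev k)(k := 0) = 0"
  by (auto simp: fun_eq_iff ev_apply)

lemma M'_ev: "M' (ev k) = U"
  by (simp add: M'_def ev_upd ev_apply)

lemma decompose: "f = scale (f k) (ev k) + f(k := 0)"
  by (auto simp: fun_eq_iff scale_apply ev_apply)

lemma M'_mult:
  assumes "f \<in> ZN N" "g \<in> ZN N"
  shows "M' f * M' g = s (Lam f g) * M' (f + g)"
proof -
  define f0 g0 where "f0 = f(k := 0)" and "g0 = g(k := 0)"
  let ?u = "f k" and ?v = "g k"
  have fg0: "f0 \<in> ZN N" "g0 \<in> ZN N" "f0 k = 0" "g0 k = 0"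
    using assms k by (auto simp: f0_def g0_def)
  have add: "(f + g)(k := 0) = f0 + g0"
    by (auto simp: f0_def g0_def fun_eq_iff)
  \<comment> \<open>\<open>e1\<close> collects the scalars of \<open>M' f * M' g\<close>, including
    those from moving \<open>M f0\<close> past the power of \<open>U\<close>; \<open>e2\<close> is
    what the claim demands. They are compared modulo l.\<close>
  define e1 where "e1 = - (?u * Lam (ev k) f0) - ?v * Lam (ev k) g0 + ?v * (2 * Lam f0 (ev k)) + Lam f0 g0"
  define e2 where "e2 = Lam f g - ((?u + ?v) * Lam (ev k) (f0 + g0))"
  have "M' f * M' g = s (- (?u * Lam (ev k) f0)) * (s (- (?v * Lam (ev k) g0)) *
      (U powi ?u * ((M f0 * U powi ?v) * M g0)))"
    by (simp only: M'_def f0_def[symmetric] g0_def[symmetric] mult.assoc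
        s_left_commute[of "U powi ?u"] s_left_commute[of "M f0"])
  also have "\<dots> = s e1 * (U powi ?u * (U powi ?v * M (f0 + g0)))"
    unfolding M_commute_U_power[OF fg0(1,3)]
    by (simp only: mult.assoc M_mult[OF fg0(1,2)] s_left_commute[of "U powi ?u"]
        s_left_commute[of "U powi ?v"] s_mult_left e1_def) (simp add: algebra_simps)
  also have "\<dots> = s e1 * (U powi (?u + ?v) * M (f0 + g0))"
    using U_nonzero by (simp add: power_int_add mult.assoc)
  also have "s e1 = s e2"
  proof (rule s_cong)
    have "Lam f g = Lam (scale ?u (ev k) + f0) (scale ?v (ev k) + g0)"
      using decompose[of f] decompose[of g] by (simp add: f0_def g0_def)
    also have "\<dots> = ?u * ?v * Lam (ev k) (ev k) + ?u * Lam (ev k) g0 + ?v * Lam f0 (ev k) + Lam f0 g0"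
      by (simp add: bform_add_left bform_add_right bform_scale_left bform_scale_right algebra_simps)
    finally have "e1 - e2 = ?v * (Lam f0 (ev k) + Lam (ev k) f0) - ?u * ?v * Lam (ev k) (ev k)"
      by (simp add: e1_def e2_def bform_add_right algebra_simps)
    then show "int l dvd e1 - e2"
      using Lam_skew[of f0 "ev k"] Lam_self[of "ev k"] by simp
  qed
  also have "s e2 * (U powi (?u + ?v) * M (f0 + g0)) = s (Lam f g) * M' (f + g)"
    by (simp add: M'_def add s_mult_left e2_def)
  finally show ?thesis .
qed

text \<open>Both exponents in \<open>U\<close> have k-th entry 1, because
  \<open>b k = 0\<close>.\<close>

lemma U_level: "x \<in> level k m \<Longrightarrow> U * x \<in> level k (m + 1)"
proof (induction rule: level.induct)
  case level_0
  then show ?case by (simp add: level.level_0)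
next
  case (level_add c f x)
  have pull: "M g * (\<sigma> c * M f) = \<sigma> (c * zpow l z (Lam g f)) * M (g + f)" if "g \<in> ZN N" for g
  proof -
    have "M g * (\<sigma> c * M f) = \<sigma> c * (M g * M f)"
      using \<sigma>_commute[OF Zz_Qz[OF level_add(1)], of "M g"] by (simp add: mult.assoc[symmetric])
    then show ?thesis
      using that level_add by (simp add: M_mult s_def \<sigma>_mult Zz_Qz zpow_Zz mult.assoc)
  qed
  have "U * (\<sigma> c * M f + x) = \<sigma> (c * zpow l z (Lam (ev k) f)) * M (ev k + f)
      + (\<sigma> (c * zpow l z (Lam (ev k + b) f)) * M (ev k + b + f) + U * x)"
    unfolding distrib_left[of U] unfolding U_def distrib_right[of _ _ "\<sigma> c * M f"] pull[OF ek] pull[OF ekb]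
    by (simp only: add.assoc)
  also have "\<dots> \<in> level k (m + 1)"
    using level_add ek ekb bk
    by (intro level.level_add rg_mult zpow_Zz) (auto simp: ev_apply)
  finally show ?case .
qed

lemma U_power_level: "x \<in> level k m \<Longrightarrow> U ^ n * x \<in> level k (m + int n)"
proof (induction n)
  case (Suc n)
  then show ?case
    using U_level[of "U ^ n * x" "m + int n"] by (simp add: mult.assoc add.commute add.left_commute)
qed simp

text \<open>A high power of \<open>U\<close> clears the negative ones. Sorting by the k-th entry
  leaves terms U^m w with w of degree 0. Their degrees are distinct, so each vanishes,
  \<open>U\<close> cancels, and w = 0 is a relation in the old frame.\<close>

lemma M'_independent:
  assumes S: "finite S" "S \<subseteq> ZN N" "\<forall>f\<in>S. c f \<in> Zz z" "(\<Sum>f\<in>S. \<sigma> (c f) * M' f) = 0"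
  shows "\<forall>f\<in>S. c f = 0"
proof
  fix f0 assume f0: "f0 \<in> S"
  \<comment> \<open>Large enough that \<open>n + f k\<close> is nonnegative for every
    \<open>f\<close> in \<open>S\<close>.\<close>
  define n where "n = Max ((\<lambda>f. nat (- f k)) ` S)"
  have n: "0 \<le> int n + f k" if "f \<in> S" for f
  proof -
    have "nat (- f k) \<le> n"
      unfolding n_def using that S(1) by (intro Max_ge) auto
    then show ?thesis by linarith
  qed
  \<comment> \<open>\<open>d\<close> absorbs the normalising scalar of \<open>M'\<close>, a unit of
    Z[zeta]; \<open>w m\<close> gathers the right factor of the m-th power of
    \<open>U\<close>.\<close>
  define d where "d f = c f * zpow l z (- (f k * Lam (ev k) (f(k := 0))))" for f
  define w where "w m = (\<Sum>f\<in>{f\<in>S. f k = m}. \<sigma> (d f) * M (f(k := 0)))" for m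
  have d: "d f \<in> Zz z" if "f \<in> S" for f
    unfolding d_def using that S(3) by (intro rg_mult zpow_Zz) auto
  have w: "w m \<in> level k 0" for m
    unfolding w_def using S d k by (intro level_sum) auto
  have M': "U ^ n * (\<sigma> (c f) * M' f) = U ^ nat (int n + f k) * (\<sigma> (d f) * M (f(k := 0)))" if "f \<in> S" for f
  proof -
    have cf: "c f \<in> Qz z" "zpow l z i \<in> Qz z" for i
      using that S(3) by (auto intro: Zz_Qz zpow_Zz)
    then have df: "d f \<in> Qz z"
      unfolding d_def by (intro dg_mult)
    have "\<sigma> (c f) * M' f = \<sigma> (d f) * (U powi (f k) * M (f(k := 0)))"
      using cf by (simp add: M'_def s_def \<sigma>_mult mult.assoc d_def)
    also have "U ^ n * \<dots> = (U powi int n * U powi (f k)) * (\<sigma> (d f) * M (f(k := 0)))"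
      by (metis \<sigma>_commute[OF df] mult.assoc power_int_of_nat)
    also have "U powi int n * U powi (f k) = U powi (int n + f k)"
      using U_nonzero by (simp add: power_int_add)
    also have "\<dots> = U ^ nat (int n + f k)"
      using n[OF that] by (simp add: power_int_def)
    finally show ?thesis .
  qed
  have "(\<Sum>m\<in>(\<lambda>f. int n + f k) ` S. U ^ nat m * w (m - int n)) = 0"
  proof -
    have "0 = (\<Sum>f\<in>S. U ^ n * (\<sigma> (c f) * M' f))"
      using S(4) by (simp add: sum_distrib_left[symmetric])
    also have "\<dots> = (\<Sum>m\<in>(\<lambda>f. int n + f k) ` S. \<Sum>f\<in>{f\<in>S. int n + f k = m}. U ^ n * (\<sigma> (c f) * M' f))"
      by (rule sum.image_gen[OF S(1)])
    also have "\<dots> = (\<Sum>m\<in>(\<lambda>f. int n + f k) ` S. U ^ nat m * w (m - int n))"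
    proof (rule sum.cong[OF refl])
      fix m
      have "(\<Sum>f\<in>{f\<in>S. int n + f k = m}. U ^ n * (\<sigma> (c f) * M' f))
          = (\<Sum>f\<in>{f\<in>S. f k = m - int n}. U ^ nat m * (\<sigma> (d f) * M (f(k := 0))))"
        by (rule sum.cong) (auto simp: M')
      then show "(\<Sum>f\<in>{f\<in>S. int n + f k = m}. U ^ n * (\<sigma> (c f) * M' f)) = U ^ nat m * w (m - int n)"
        by (simp add: w_def sum_distrib_left)
    qed
    finally show ?thesis ..
  qed
  then have "U ^ nat (int n + f0 k) * w (int n + f0 k - int n) = 0"
  proof (rule level_independent[where k = k, rotated 2])
    fix m assume "m \<in> (\<lambda>f. int n + f k) ` S"
    then have "0 \<le> m"
      using n by auto
    then show "U ^ nat m * w (m - int n) \<in> level k m"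
      using U_power_level[OF w, of "nat m"] by simp
  qed (use S(1) f0 in auto)
  then have "w (f0 k) = 0"
    using U_nonzero by simp
  then have "d f0 = 0"
    unfolding w_def
  proof (rule M_independent[rotated -2])
    \<comment> \<open>Among exponents with the same k-th entry, erasing that entry loses
      nothing.\<close>
    show "inj_on (\<lambda>f. f(k := 0)) {f \<in> S. f k = f0 k}"
    proof (rule inj_onI)
      fix f g assume fg: "f \<in> {f \<in> S. f k = f0 k}" "g \<in> {f \<in> S. f k = f0 k}" "f(k := 0) = g(k := 0)"
      then have "f k = g k" by simp
      moreover have "f i = g i" if "i \<noteq> k" for i
        using fun_cong[OF fg(3), of i] that by simp
      ultimately show "f = g" by (metis ext)
    qed
  qed (use S d f0 k in auto)
  then show "c f0 = 0"
    by (auto simp: d_def zpow_eq z_nonzero)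
qed

text \<open>The factorisation U = M(e_k) V, with V built from exponents whose k-th entry is 0,
  recovers M(e_k) as U V^(-1). As V is in general not a monomial, this takes place in the division
  ring.\<close>

lemma M'_generate: "divring_gen (M' ` ZN N \<union> \<sigma> ` Zz z) = UNIV"
proof -
  let ?D = "divring_gen (M' ` ZN N \<union> \<sigma> ` Zz z)"
  have s: "s a \<in> ?D" for a
    using s_Zz by (auto intro: dg_base)
  have M0: "M f \<in> ?D" if "f \<in> ZN N" "f k = 0" for f
    using that M'_eq_M by (metis UnI1 dg_base imageI)
  have U: "U \<in> ?D"
    using M'_ev ek by (metis UnI1 dg_base imageI)
  define V where "V = 1 + s (- Lam (ev k) b) * M b"
  have V: "V \<in> ?D"
    unfolding V_def by (intro dg_add dg_one dg_mult s M0 b bk)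
  have UV: "U = M (ev k) * V"
    using M_mult[OF ek b] by (simp add: U_def V_def distrib_left s_left_commute[of "M (ev k)"] s_mult_left)
  then have "V \<noteq> 0"
    using U_nonzero by auto
  then have "M (ev k) = U * inverse V"
    by (simp add: UV mult.assoc)
  then have Mk: "M (ev k) \<in> ?D"
    using U V by (auto intro: dg_mult dg_inv)
  have "M f \<in> ?D" if "f \<in> ZN N" for f
  proof -
    have "M (scale (f k) (ev k)) * M (f(k := 0)) = s (Lam (scale (f k) (ev k)) (f(k := 0))) * M f"
      using that k decompose[of f] by (subst M_mult) auto
    then have "M f = s (- Lam (scale (f k) (ev k)) (f(k := 0))) * (M (scale (f k) (ev k)) * M (f(k := 0)))"
      by (simp add: s_mult_left)
    also have "\<dots> = s (- Lam (scale (f k) (ev k)) (f(k := 0))) * (M (ev k) powi f k * M (f(k := 0)))"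
      by (simp only: M_power_int[OF ek])
    also have "\<dots> \<in> ?D"
      using that k by (intro dg_mult s divring_gen_power_int Mk M0[of "f(k := 0)"]) auto
    finally show ?thesis .
  qed
  then have "M ` ZN N \<union> \<sigma> ` Zz z \<subseteq> ?D"
    by (auto intro: dg_base)
  then show ?thesis
    using divring_gen_subset M_generate by blast
qed

lemma toric_frame_M': "toric_frame l z \<sigma> N M' lam"
proof -
  have "M' (\<lambda>_. 0) = 1"
    using M'_eq_M[of 0] M_0 by (simp add: zero_fun_def)
  moreover have "skew_mod l N lam"
    using toric by (simp add: toric_frame_def)
  ultimately show ?thesis
    using M'_mult M'_generate unfolding toric_frame_def
    by (intro conjI allI impI M'_independent) (simp_all add: plus_fun_def s_def)
qed

end

section \<open>Mutation of compatible pairs\<close>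

definition col :: "nat \<Rightarrow> (nat \<Rightarrow> nat \<Rightarrow> int) \<Rightarrow> nat \<Rightarrow> nat \<Rightarrow> int" where
  "col N B j = (\<lambda>i. if i < N then B i j else 0)"

text \<open>Multiplication by the matrix that has \<open>w\<close>, with \<open>-1\<close> at the place \<open>k\<close>, as its \<open>k\<close>-th column
  and coincides with the identity elsewhere.\<close>

definition elin :: "nat \<Rightarrow> (nat \<Rightarrow> int) \<Rightarrow> (nat \<Rightarrow> int) \<Rightarrow> nat \<Rightarrow> int" where
  "elin k w f = f + scale (f k) (w - scale 2 (ev k))"

lemma elin_apply: "elin k w f i = f i + f k * (w i - 2 * (if i = k then 1 else 0))"
  by (simp add: elin_def scale_apply ev_apply)

lemma elin_add: "elin k w (f + g) = elin k w f + elin k w g"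
  by (simp add: fun_eq_iff elin_apply algebra_simps)

lemma elin_0 [simp]: "elin k w 0 = 0"
  by (simp add: fun_eq_iff elin_apply)

lemma elin_id: "f k = 0 \<Longrightarrow> elin k w f = f"
  by (simp add: fun_eq_iff elin_apply)

lemma elin_elin: "w k = 0 \<Longrightarrow> elin k w (elin k w f) = f"
  by (simp add: fun_eq_iff elin_apply algebra_simps)

lemma elin_ZN: "w \<in> ZN N \<Longrightarrow> k < N \<Longrightarrow> f \<in> ZN N \<Longrightarrow> elin k w f \<in> ZN N"
  unfolding elin_def by (intro ZN_add ZN_scale ZN_diff ZN_ev)

lemma elin_ev: "elin k w (ev k) = - ev k + w"
  by (simp add: fun_eq_iff elin_apply ev_apply)

lemma col_ZN [simp]: "col N B k \<in> ZN N" "colpos N B k \<in> ZN N" "colneg N B k \<in> ZN N"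
  by (auto simp: ZN_def col_def colpos_def colneg_def)

lemma col_eq_colpos_colneg: "col N B k = colpos N B k + colneg N B k"
  by (auto simp: fun_eq_iff col_def colpos_def colneg_def)

lemma colpos_colneg_diag:
  assumes "B k k = 0"
  shows "colpos N B k k = 0" "colneg N B k k = 0" "col N B k k = 0"
  using assms by (auto simp: colpos_def colneg_def col_def)

lemma bform_mut_lam:
  assumes "B k k = 0" "k < N"
  shows "bform N (mut_lam N B k lam) f g
    = bform N lam (elin k (- colneg N B k) f) (elin k (- colneg N B k) g)"
proof -
  let ?E = "Emat B k"
  have E: "elin k (- colneg N B k) f p = (\<Sum>i<N. ?E p i * f i)"
    if "p < N" for f p
  proof -
    have "(\<Sum>i<N. ?E p i * f i) = ?E p k * f k + (\<Sum>i\<in>{..<N} - {k}. ?E p i * f i)"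
      using assms by (subst sum.remove[of _ k]) auto
    also have "(\<Sum>i\<in>{..<N} - {k}. ?E p i * f i) = (\<Sum>i\<in>{..<N} - {k}. if i = p then f i else 0)"
      by (rule sum.cong) (auto simp: Emat_def)
    finally show ?thesis
      using that assms by (auto simp: Emat_def elin_apply colneg_def)
  qed
  let ?t = "\<lambda>i j p q. (?E p i * f i) * lam p q * (?E q j * g j)"
  have "bform N (mut_lam N B k lam) f g = (\<Sum>i<N. \<Sum>j<N. \<Sum>p<N. \<Sum>q<N. ?t i j p q)"
    by (simp add: bform_def mut_lam_def sum_distrib_left sum_distrib_right mult_ac)
  also have "\<dots> = (\<Sum>i<N. \<Sum>p<N. \<Sum>j<N. \<Sum>q<N. ?t i j p q)"
    by (intro sum.cong refl sum.swap)
  also have "\<dots> = (\<Sum>p<N. \<Sum>i<N. \<Sum>j<N. \<Sum>q<N. ?t i j p q)"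
    by (rule sum.swap)
  also have "\<dots> = (\<Sum>p<N. \<Sum>i<N. \<Sum>q<N. \<Sum>j<N. ?t i j p q)"
    by (intro sum.cong refl sum.swap)
  also have "\<dots> = (\<Sum>p<N. \<Sum>q<N. \<Sum>i<N. \<Sum>j<N. ?t i j p q)"
    by (intro sum.cong refl sum.swap)
  also have "\<dots> = (\<Sum>p<N. \<Sum>q<N. (\<Sum>i<N. ?E p i * f i) * lam p q * (\<Sum>j<N. ?E q j * g j))"
    by (simp add: sum_distrib_left sum_distrib_right mult_ac)
  also have "\<dots> = bform N lam (elin k (- colneg N B k) f) (elin k (- colneg N B k) g)"
    unfolding bform_def by (intro sum.cong refl) (simp add: E)
  finally show ?thesis .
qed

text \<open>The symmetric mutation rule has two one-sided forms: the first fits the substitution by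
  \<open>- colneg\<close>, the second the one by \<open>colpos\<close>.\<close>

lemma mutB_identity:
  fixes a c :: int
  shows "(\<bar>a\<bar> * c + a * \<bar>c\<bar>) div 2 = a * max 0 c + max 0 (- a) * c"
    and "(\<bar>a\<bar> * c + a * \<bar>c\<bar>) div 2 = a * max 0 (- c) + max 0 a * c"
  by (cases "a \<ge> 0"; cases "c \<ge> 0"; simp add: max_def)+

lemma mutB_alt:
  assumes "i \<noteq> k" "j \<noteq> k"
  shows "mutB k B i j = B i j + B i k * max 0 (B k j) + max 0 (- B i k) * B k j"
    and "mutB k B i j = B i j + B i k * max 0 (- B k j) + max 0 (B i k) * B k j"
  using assms mutB_identity[of "B i k" "B k j"] by (simp_all add: mutB_def)

lemma mutB_mutB: "mutB k (mutB k B) = B"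
proof (intro ext)
  fix i j
  show "mutB k (mutB k B) i j = B i j"
    using mutB_identity(1)[of "B i k" "B k j"] mutB_identity(2)[of "- B i k" "- B k j"]
    by (simp add: mutB_def)
qed

lemma l_compatible_iff_ev:
  assumes "ex \<subseteq> {..<N}"
  shows "l_compatible l N ex lam B D \<longleftrightarrow> (\<forall>j\<in>ex. D j > 0) \<and>
     (\<forall>i\<in>ex. \<forall>j\<in>ex. D i * B i j = - (D j * B j i)) \<and>
     (\<forall>i<N. \<forall>j\<in>ex. int l dvd bform N lam (col N B j) (ev i) - D j * ev i j)"
proof -
  have "bform N lam (col N B j) (ev i) = (\<Sum>k<N. B k j * lam k i)" if "i < N" for i j
    using that by (simp add: bform_def col_def ev_apply if_distrib[of "\<lambda>x. _ * x"] cong: if_cong)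
  then have "(\<Sum>k<N. B k j * lam k i) mod int l = (if i = j then D j else 0) mod int l \<longleftrightarrow>
      int l dvd bform N lam (col N B j) (ev i) - D j * ev i j" if "i < N" for i j
    using that by (auto simp: mod_eq_dvd_iff ev_apply)
  then show ?thesis
    unfolding l_compatible_def by auto
qed

text \<open>By linearity the basis vectors suffice. In this basis-free form, compatibility can be
  evaluated at the image of any vector under E.\<close>

lemma l_compatible_iff:
  assumes "ex \<subseteq> {..<N}"
  shows "l_compatible l N ex lam B D \<longleftrightarrow> (\<forall>j\<in>ex. D j > 0) \<and>
     (\<forall>i\<in>ex. \<forall>j\<in>ex. D i * B i j = - (D j * B j i)) \<and>
     (\<forall>j\<in>ex. \<forall>g. int l dvd bform N lam (col N B j) g - D j * g j)"
proof -
  have "int l dvd bform N lam (col N B j) g - D j * g j"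
    if "j \<in> ex" and *: "\<forall>i<N. int l dvd bform N lam (col N B j) (ev i) - D j * ev i j" for j g
  proof -
    have "g j = (\<Sum>i<N. ev i j * g i)"
      using that assms by (auto simp: ev_apply if_distrib[of "\<lambda>x. x * _"] cong: if_cong)
    then have "bform N lam (col N B j) g - D j * g j
        = (\<Sum>i<N. (bform N lam (col N B j) (ev i) - D j * ev i j) * g i)"
      by (simp add: bform_expand_right[of N lam "col N B j" g] sum_subtractf left_diff_distrib sum_distrib_left mult.assoc)
    also have "int l dvd \<dots>"
      using * by (intro dvd_sum dvd_mult2) auto
    finally show ?thesis .
  qed
  then show ?thesis
    unfolding l_compatible_iff_ev[OF assms] by meson
qed

lemma l_compatible_diag: "l_compatible l N ex lam B D \<Longrightarrow> k \<in> ex \<Longrightarrow> B k k = 0"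
  unfolding l_compatible_def by (metis add_eq_0_iff_both_eq_0 eq_neg_iff_add_eq_0 less_irrefl mult_eq_0_iff double_zero)

lemma l_compatible_mutate:
  assumes ex: "ex \<subseteq> {..<N}" and k: "k \<in> ex" and compat: "l_compatible l N ex lam B D"
    and w: "w = - colneg N B k \<or> w = colpos N B k"
    and lam': "\<And>f g. f \<in> ZN N \<Longrightarrow> g \<in> ZN N \<Longrightarrow>
      int l dvd bform N lam' f g - bform N lam (elin k w f) (elin k w g)"
  shows "l_compatible l N ex lam' (mutB k B) D"
proof -
  have kN: "k < N" using ex k by auto
  have Bkk: "B k k = 0"
    using l_compatible_diag[OF compat k] .
  have D: "\<And>j. j \<in> ex \<Longrightarrow> D j > 0"
    and skew: "\<And>i j. i \<in> ex \<Longrightarrow> j \<in> ex \<Longrightarrow> D i * B i j = - (D j * B j i)"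
    and form: "\<And>j g. j \<in> ex \<Longrightarrow> int l dvd bform N lam (col N B j) g - D j * g j"
    using compat unfolding l_compatible_iff[OF ex] by blast+
  have skew': "D i * mutB k B i j = - (D j * mutB k B j i)" if ij: "i \<in> ex" "j \<in> ex" for i j
  proof (cases "i = k \<or> j = k")
    case True
    then show ?thesis
      using skew[OF ij] by (auto simp: mutB_def)
  next
    case False
    have max: "D p * max 0 x = max 0 (D p * x)" if "p \<in> ex" for p x
      using D[OF that] by (simp add: max_mult_distrib_left)
    have 1: "D k * max 0 (B k j) = D j * max 0 (- B j k)"
      using skew[OF k ij(2)] by (simp add: max k ij)
    have 2: "D i * max 0 (- B i k) = D k * max 0 (B k i)"
      using skew[OF ij(1) k] by (simp add: max k ij)
    have "D i * mutB k B i j = D i * B i j + (D i * B i k) * max 0 (B k j) + (D i * max 0 (- B i k)) * B k j"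
      using False by (simp add: mutB_alt(1) algebra_simps)
    also have "\<dots> = - (D j * B j i) - B k i * (D k * max 0 (B k j)) + max 0 (B k i) * (D k * B k j)"
      unfolding 2 skew[OF ij] skew[OF ij(1) k] by (simp add: algebra_simps)
    also have "\<dots> = - (D j * (B j i + B j k * max 0 (B k i) + max 0 (- B j k) * B k i))"
      unfolding 1 skew[OF k ij(2)] by (simp add: algebra_simps)
    also have "\<dots> = - (D j * mutB k B j i)"
      using False by (simp add: mutB_alt(1))
    finally show ?thesis .
  qed
  have wk: "w k = 0"
    using w colpos_colneg_diag[of B k N] Bkk by auto
  define E where "E = elin k w"
  have form': "int l dvd bform N lam' (col N (mutB k B) j) (ev i) - D j * ev i j"
    if j: "j \<in> ex" and i: "i < N" for i j
  proof -
    have d1: "int l dvd bform N lam' (col N (mutB k B) j) (ev i) - bform N lam (E (col N (mutB k B) j)) (E (ev i))"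
      unfolding E_def using i by (intro lam') auto
    have Ek: "E (ev i) k = - ev i k"
      by (simp add: E_def elin_apply wk)
    show ?thesis
    proof (cases "j = k")
      case True
      have c: "E (col N (mutB k B) j) = - col N B k"
        using Bkk True by (auto simp: E_def fun_eq_iff elin_apply col_def mutB_def)
      have d2: "int l dvd bform N lam (col N B k) (E (ev i)) - D k * E (ev i) k"
        using form[OF k] .
      show ?thesis
        using dvd_diff[OF d1 d2] True unfolding c Ek by (simp add: bform_minus_left)
    next
      case False
      \<comment> \<open>The multiple of b^k prescribed by the one-sided mutation rule for the chosen
        sign.\<close>
      define c where "c = (if w = - colneg N B k then max 0 (B k j) else max 0 (- B k j))"
      have c: "E (col N (mutB k B) j) = col N B j + scale c (col N B k)"
      proof
        fix p
        show "E (col N (mutB k B) j) p = (col N B j + scale c (col N B k)) p"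
        proof (cases "p < N \<and> p \<noteq> k")
          case True
          have "E (col N (mutB k B) j) p = mutB k B p j + mutB k B k j * w p"
            using True kN by (simp add: E_def elin_apply col_def)
          also have "\<dots> = mutB k B p j - B k j * w p"
            by (simp add: mutB_def)
          also have "\<dots> = B p j + B p k * c"
          proof (cases "w = - colneg N B k")
            case w: True
            then have "w p = max 0 (- B p k)"
              using True by (auto simp: colneg_def)
            then show ?thesis
              using w True False by (simp add: mutB_alt(1) c_def)
          next
            case w': False
            then have "w p = max 0 (B p k)"
              using True w by (auto simp: colpos_def)
            then show ?thesis
              using w' True False by (simp add: mutB_alt(2) c_def)
          qed
          finally show ?thesis
            using True by (simp add: col_def scale_apply)
        next
          case False
          then show ?thesis
            using \<open>j \<noteq> k\<close> wk Bkk w kN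
            by (auto simp: E_def elin_apply col_def scale_apply mutB_def colneg_def colpos_def)
        qed
      qed
      have d2: "int l dvd bform N lam (col N B j) (E (ev i)) - D j * E (ev i) j"
        using form[OF j] .
      have d3: "int l dvd c * (bform N lam (col N B k) (E (ev i)) - D k * E (ev i) k)"
        using form[OF k] by (rule dvd_mult)
      have Ej: "E (ev i) j = ev i j + ev i k * w j"
        using False by (simp add: E_def elin_apply)
      \<comment> \<open>Skew-symmetry of DB trades the part \<open>w j\<close> of b_jk for the part
        of b_kj of the opposite sign.\<close>
      have Dw: "D j * w j = c * D k"
      proof -
        have max: "D p * max 0 x = max 0 (D p * x)" if "p \<in> ex" for p x
          using D[OF that] by (simp add: max_mult_distrib_left)
        have 1: "D k * max 0 (B k j) = D j * max 0 (- B j k)" "D k * max 0 (- B k j) = D j * max 0 (B j k)"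
          using skew[OF k j] by (simp_all add: max k j)
        have jN: "j < N"
          using j ex by auto
        show ?thesis
        proof (cases "w = - colneg N B k")
          case w: True
          then have "w j = max 0 (- B j k)"
            using jN by (auto simp: colneg_def)
          then show ?thesis
            using w 1 by (simp add: c_def mult.commute)
        next
          case w': False
          then have "w j = max 0 (B j k)"
            using jN w by (auto simp: colpos_def)
          then show ?thesis
            using w' 1 by (simp add: c_def mult.commute)
        qed
      qed
      have "bform N lam' (col N (mutB k B) j) (ev i) - D j * ev i j
        = (bform N lam' (col N (mutB k B) j) (ev i) - bform N lam (E (col N (mutB k B) j)) (E (ev i)))
          + ((bform N lam (col N B j) (E (ev i)) - D j * E (ev i) j)
          + c * (bform N lam (col N B k) (E (ev i)) - D k * E (ev i) k))
          + ev i k * (D j * w j - c * D k)"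
        unfolding c Ek Ej by (simp add: bform_add_left bform_scale_left algebra_simps)
      also have "int l dvd \<dots>"
        using d1 d2 d3 Dw by (intro dvd_add) simp_all
      finally show ?thesis .
    qed
  qed
  show ?thesis
    unfolding l_compatible_iff_ev[OF ex] using D skew' form' by blast
qed

section \<open>Quantum mutations\<close>

text \<open>Mutation matrices in different directions may coincide, so a mutation step need not determine
  its direction and \<open>k\<close> is kept explicit.\<close>

definition qmut_dir :: "nat \<Rightarrow> complex \<Rightarrow> (complex \<Rightarrow> 'f::division_ring) \<Rightarrow> nat \<Rightarrow> nat \<Rightarrow>
    ((nat \<Rightarrow> int) \<Rightarrow> 'f) \<times> (nat \<Rightarrow> nat \<Rightarrow> int) \<Rightarrow> ((nat \<Rightarrow> int) \<Rightarrow> 'f) \<times> (nat \<Rightarrow> nat \<Rightarrow> int) \<Rightarrow> bool" where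
  "qmut_dir l z \<sigma> N k t t' \<longleftrightarrow>
     (\<exists>lam. toric_frame l z \<sigma> N (fst t) lam \<and>
        toric_frame l z \<sigma> N (fst t') (mut_lam N (snd t) k lam) \<and>
        (\<forall>j<N. j \<noteq> k \<longrightarrow> fst t' (ev j) = fst t (ev j)) \<and>
        fst t' (ev k) = fst t (\<lambda>i. - ev k i + colpos N (snd t) k i) + fst t (\<lambda>i. - ev k i - colneg N (snd t) k i) \<and>
        snd t' = mutB k (snd t))"

lemma qmut_step_iff: "qmut_step l z \<sigma> N ex t t' \<longleftrightarrow> (\<exists>k\<in>ex. qmut_dir l z \<sigma> N k t t')"
  by (simp add: qmut_step_def qmut_dir_def)

context frame begin

text \<open>E is an involution of the exponent lattice, so it permutes the monomials and pulls the
  form back.\<close>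

lemma toric_frame_elin:
  assumes B: "B k k = 0" and k: "k < N"
  shows "toric_frame l z \<sigma> N (\<lambda>f. M (elin k (- colneg N B k) f)) (mut_lam N B k lam)"
proof -
  let ?w = "- colneg N B k"
  let ?E = "elin k ?w"
  let ?M = "\<lambda>f. M (?E f)"
  let ?lam = "mut_lam N B k lam"
  have wk: "?w k = 0"
    using colpos_colneg_diag(2)[of B k N] B by simp
  have w: "?w \<in> ZN N"
    by (intro ZN_minus) simp
  note EZ = elin_ZN[OF w k]
  note form = bform_mut_lam[of B k N lam, OF B k]
  have "skew_mod l N ?lam"
    unfolding skew_mod_def
  proof (intro allI impI)
    fix i j assume "i < N" "j < N"
    then show "(?lam i j + ?lam j i) mod int l = 0"
      using Lam_skew[of "?E (ev i)" "?E (ev j)"]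
      by (simp add: form[symmetric] bform_ev dvd_eq_mod_eq_0)
  qed
  moreover have "?M (\<lambda>_. 0) = 1"
    using elin_0[of k ?w] M_0 by (simp add: zero_fun_def)
  moreover have "?M f * ?M g = \<sigma> (zpow l z (bform N ?lam f g)) * ?M (\<lambda>i. f i + g i)"
    if "f \<in> ZN N" "g \<in> ZN N" for f g
  proof -
    have "?M f * ?M g = \<sigma> (zpow l z (bform N ?lam f g)) * ?M (f + g)"
      using M_mult[OF EZ EZ, OF that] by (simp only: form elin_add s_def)
    then show ?thesis
      by (simp only: plus_fun_def)
  qed
  moreover have "\<forall>f\<in>S. c f = 0"
    if "finite S \<and> S \<subseteq> ZN N \<and> (\<forall>f\<in>S. c f \<in> Zz z) \<and> (\<Sum>f\<in>S. \<sigma> (c f) * ?M f) = 0" for S c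
  proof
    fix f assume "f \<in> S"
    show "c f = 0"
    proof (rule M_independent[where h = ?E])
      show "inj_on ?E S"
        by (rule inj_on_inverseI[of _ ?E]) (rule elin_elin[of ?w k, OF wk])
    qed (use that \<open>f \<in> S\<close> EZ in auto)
  qed
  moreover have "?M ` ZN N = M ` ZN N"
  proof -
    have "?E ` ZN N = ZN N"
      using EZ elin_elin[of ?w k, OF wk] by (metis (no_types, lifting) image_eqI image_subsetI subsetI subset_antisym)
    then show ?thesis
      by (metis image_image)
  qed
  ultimately show ?thesis
    using M_generate unfolding toric_frame_def by simp
qed

end

section \<open>Existence of mutations and the exchange relation for l-th powers\<close>

locale compatible_frame = frame l z \<sigma> N M lam
  for l :: nat and z :: complex and \<sigma> :: "complex \<Rightarrow> 'f::division_ring"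
    and N :: nat and M :: "(nat \<Rightarrow> int) \<Rightarrow> 'f" and lam :: "nat \<Rightarrow> nat \<Rightarrow> int" +
  fixes ex :: "nat set" and B :: "nat \<Rightarrow> nat \<Rightarrow> int" and D :: "nat \<Rightarrow> int"
  assumes ex: "ex \<subseteq> {..<N}" and compat: "l_compatible l N ex lam B D"
    and copr: "\<And>k. k \<in> ex \<Longrightarrow> coprime (int l) (D k)"
begin

lemma ex_less: "k \<in> ex \<Longrightarrow> k < N"
  using ex by auto

lemma B_diag: "k \<in> ex \<Longrightarrow> B k k = 0"
  using l_compatible_diag[OF compat] .

lemma Lam_col: "k \<in> ex \<Longrightarrow> int l dvd Lam (col N B k) g - D k * g k"
  using compat unfolding l_compatible_iff[OF ex] by blast

lemma ex_mutation:
  assumes k: "k \<in> ex"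
  shows "\<exists>M'. qmut_dir l z \<sigma> N k (M, B) (M', mutB k B)"
proof -
  let ?w = "- colneg N B k"
  let ?E = "elin k ?w"
  let ?lam = "mut_lam N B k lam"
  have wk: "?w k = 0"
    using colpos_colneg_diag(2)[of B k N] B_diag[OF k] by simp
  have colk: "col N B k k = 0"
    using colpos_colneg_diag(3)[of B k N] B_diag[OF k] by simp
  note form = bform_mut_lam[of B k N lam, OF B_diag[OF k] ex_less[OF k]]
  \<comment> \<open>E sends e_k and e_k + b^k to the two exponents of the exchange relation, and
    fixes b^k because b_kk = 0.\<close>
  interpret X: exchange l z \<sigma> N "\<lambda>f. M (?E f)" ?lam k "col N B k"
  proof unfold_locales
    show "toric_frame l z \<sigma> N (\<lambda>f. M (?E f)) ?lam"
      by (rule toric_frame_elin[of B k, OF B_diag[OF k] ex_less[OF k]])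
    show "int l dvd bform N ?lam (col N B k) (ev j)" if "j < N" "j \<noteq> k" for j
    proof -
      have "ev j k = 0"
        using that by (simp add: ev_apply)
      then show ?thesis
        using Lam_col[OF k, of "ev j"] colk by (simp add: form elin_id)
    qed
  qed (use ex_less[OF k] colk in auto)
  have 1: "X.M' (ev j) = M (ev j)" if "j \<noteq> k" for j
  proof -
    have "ev j k = 0"
      using that by (simp add: ev_apply)
    then show ?thesis
      by (simp add: X.M'_eq_M elin_id)
  qed
  have 2: "X.M' (ev k) = M (\<lambda>i. - ev k i + colpos N B k i) + M (\<lambda>i. - ev k i - colneg N B k i)"
  proof -
    have "?E (ev k + col N B k) = (\<lambda>i. - ev k i + colpos N B k i)"
      using colk by (simp add: elin_add elin_ev elin_id) (simp add: fun_eq_iff col_eq_colpos_colneg)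
    moreover have "?E (ev k) = (\<lambda>i. - ev k i - colneg N B k i)"
      by (simp add: elin_ev fun_eq_iff)
    ultimately show ?thesis
      by (simp add: X.M'_ev X.U_def add.commute)
  qed
  have "qmut_dir l z \<sigma> N k (M, B) (X.M', mutB k B)"
    unfolding qmut_dir_def fst_conv snd_conv
    by (intro exI[of _ lam] conjI allI impI toric X.toric_frame_M' 1 2 refl)
  then show ?thesis
    by (intro exI[of _ X.M'])
qed

text \<open>The factor \<open>M (ev k) ^ l\<close> clears -e_k from both exponents and leaves the
  two monomials of the classical exchange relation.\<close>

lemma exchange_power:
  assumes k: "k \<in> ex"
  shows "(M (- ev k + colpos N B k) + M (- ev k - colneg N B k)) ^ l * M (ev k) ^ l
    = M (scale (int l) (colpos N B k)) + M (scale (int l) (- colneg N B k))"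
proof -
  define a c where "a = - ev k + colpos N B k" and "c = - ev k - colneg N B k"
  have kN: "k < N" by (rule ex_less[OF k])
  have ac: "a \<in> ZN N" "c \<in> ZN N"
    using kN by (auto simp: a_def c_def intro!: ZN_diff)
  \<comment> \<open>The exponents differ by b^k and \<open>c k = - 1\<close>, so compatibility makes
    \<open>Lam a c\<close> congruent to \<open>- D k\<close> modulo l.\<close>
  have "a = c + col N B k"
    by (simp add: a_def c_def col_eq_colpos_colneg)
  then have "Lam a c = Lam c c + Lam (col N B k) c"
    by (simp add: bform_add_left)
  moreover have "c k = - 1"
    using colpos_colneg_diag(2)[of B k N] B_diag[OF k] by (simp add: c_def ev_apply)
  ultimately have Lam: "int l dvd Lam a c + D k"
    using Lam_col[OF k, of c] Lam_self[of c] by (simp add: add.assoc)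
  have "(M a + M c) ^ l = M a ^ l + M c ^ l"
  proof (rule quantum_frobenius[where q = "s (2 * Lam a c)"])
    show "M a * M c = s (2 * Lam a c) * (M c * M a)"
      by (rule M_commute[OF ac])
    show "s (2 * Lam a c) ^ l = 1"
      by (simp add: s_power s_eq_1_iff)
    fix m assume m: "0 < m" "m < l"
    show "s (2 * Lam a c) ^ m \<noteq> 1"
    proof
      assume "s (2 * Lam a c) ^ m = 1"
      then have "int l dvd int m * (2 * Lam a c)"
        by (simp add: s_power s_eq_1_iff)
      \<comment> \<open>This trades \<open>Lam a c\<close> for \<open>D k\<close>; coprimality then
        cancels \<open>D k\<close>, and oddness cancels 2.\<close>
      moreover have "int l dvd int m * 2 * (Lam a c + D k)"
        using Lam by (rule dvd_mult)
      ultimately have "int l dvd int m * 2 * (Lam a c + D k) - int m * (2 * Lam a c)"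
        by (rule dvd_diff[rotated])
      then have "int l dvd int m * 2 * D k"
        by (simp add: algebra_simps)
      then have "int l dvd int m * 2"
        using copr[OF k] by (simp add: coprime_dvd_mult_left_iff)
      moreover have "coprime (int l) 2"
        using l_odd by simp
      ultimately have "int l dvd int m"
        by (simp add: coprime_dvd_mult_left_iff)
      then show False
        using m by (simp add: nat_dvd_not_less)
    qed
  qed (use s_commute l_pos in auto)
  also have "\<dots> * M (ev k) ^ l = M (scale (int l) (a + ev k)) + M (scale (int l) (c + ev k))"
    using ac kN by (simp only: M_power ZN_ev distrib_right M_scale_l_mult ZN_scale scale_add_right)
  also have "a + ev k = colpos N B k"
    by (simp add: a_def)
  also have "c + ev k = - colneg N B k"
    by (simp add: c_def)
  finally show ?thesis
    by (simp only: a_def c_def)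
qed

end

context root_of_unity begin

text \<open>\<open>D\<close> is a parameter, since mutation preserves it and coprimality refers to
  it; the matrix of the form is quantified, since it varies with the frame.\<close>

definition good_seed :: "nat \<Rightarrow> nat set \<Rightarrow> (nat \<Rightarrow> int) \<Rightarrow> ((nat \<Rightarrow> int) \<Rightarrow> 'f) \<times> (nat \<Rightarrow> nat \<Rightarrow> int) \<Rightarrow> bool" where
  "good_seed N ex D t \<longleftrightarrow> (\<exists>lam. compatible_frame l z \<sigma> N (fst t) lam ex (snd t) D)"

lemma l_compatible_cong:
  assumes ex: "ex \<subseteq> {..<N}"
    and "l_compatible l N ex lam B D" "\<And>i j. i < N \<Longrightarrow> j < N \<Longrightarrow> int l dvd lam i j - lam' i j"
  shows "l_compatible l N ex lam' B D"
proof -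
  have "int l dvd bform N lam f g - bform N lam' f g" for f g
  proof -
    have "bform N lam f g - bform N lam' f g = (\<Sum>i<N. \<Sum>j<N. f i * (lam i j - lam' i j) * g j)"
      by (simp add: bform_def sum_subtractf algebra_simps)
    also have "int l dvd \<dots>"
      using assms(3) by (intro dvd_sum dvd_mult2 dvd_mult) auto
    finally show ?thesis .
  qed
  then have "int l dvd bform N lam' f g - x \<longleftrightarrow> int l dvd bform N lam f g - x" for f g x
    using dvd_add_right_iff[of "int l" "bform N lam f g - bform N lam' f g" "bform N lam' f g - x"]
    by simp
  then show ?thesis
    using assms(2) unfolding l_compatible_iff[OF ex] by blast
qed


lemma good_seed_quantum_seed: "good_seed N ex D t \<Longrightarrow> quantum_seed l z \<sigma> N ex (fst t) (snd t)"
  unfolding good_seed_def quantum_seed_def compatible_frame_def compatible_frame_axioms_def frame_def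
    frame_axioms_def by blast

text \<open>The matrix supplied by a mutation step may differ from the stored one, but by
  \<open>lam_unique\<close> they agree modulo l, which is all that compatibility sees.\<close>

lemma good_seed_lam:
  assumes "good_seed N ex D t" "toric_frame l z \<sigma> N (fst t) lam"
  shows "compatible_frame l z \<sigma> N (fst t) lam ex (snd t) D"
proof -
  obtain lam0 where "compatible_frame l z \<sigma> N (fst t) lam0 ex (snd t) D"
    using assms(1) unfolding good_seed_def by blast
  then interpret T: compatible_frame l z \<sigma> N "fst t" lam0 ex "snd t" D .
  show ?thesis
  proof unfold_locales
    show "l_compatible l N ex lam (snd t) D"
      by (rule l_compatible_cong[OF T.ex T.compat]) (rule T.lam_unique[OF assms(2)])
  qed (use assms(2) T.ex T.copr in auto)
qed

text \<open>Either end may be the known one, because the equivalence closure also reverses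
  steps.\<close>

lemma good_seed_step:
  assumes step: "qmut_step l z \<sigma> N ex t t'" and good: "good_seed N ex D t \<or> good_seed N ex D t'"
  shows "good_seed N ex D t \<and> good_seed N ex D t'"
proof -
  obtain k lam where k: "k \<in> ex" and lam: "toric_frame l z \<sigma> N (fst t) lam"
    and lam': "toric_frame l z \<sigma> N (fst t') (mut_lam N (snd t) k lam)"
    and B': "snd t' = mutB k (snd t)"
    using step unfolding qmut_step_def by blast
  from good show ?thesis
  proof
    assume t: "good_seed N ex D t"
    interpret T: compatible_frame l z \<sigma> N "fst t" lam ex "snd t" D
      by (rule good_seed_lam[OF t lam])
    have "l_compatible l N ex (mut_lam N (snd t) k lam) (snd t') D"
      unfolding B'
      by (rule l_compatible_mutate[OF T.ex k T.compat, of "- colneg N (snd t) k"])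
        (simp_all add: bform_mut_lam T.B_diag[OF k] T.ex_less[OF k])
    then have "compatible_frame l z \<sigma> N (fst t') (mut_lam N (snd t) k lam) ex (snd t') D"
      using lam' T.ex T.copr by unfold_locales auto
    then show ?thesis
      using t good_seed_def by blast
  next
    assume t': "good_seed N ex D t'"
    interpret T: compatible_frame l z \<sigma> N "fst t'" "mut_lam N (snd t) k lam" ex "snd t'" D
      by (rule good_seed_lam[OF t' lam'])
    have Bkk: "snd t k k = 0"
      using T.B_diag[OF k] by (simp add: B' mutB_def)
    \<comment> \<open>The backward substitution thus coincides with the forward E, which is its own
      inverse.\<close>
    have w: "colpos N (snd t') k = - colneg N (snd t) k"
      by (auto simp: fun_eq_iff colpos_def colneg_def B' mutB_def)
    have "l_compatible l N ex lam (mutB k (snd t')) D"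
    proof (rule l_compatible_mutate[OF T.ex k T.compat, of "colpos N (snd t') k"])
      fix f g assume "f \<in> ZN N" "g \<in> ZN N"
      have "(- colneg N (snd t) k) k = 0"
        using colpos_colneg_diag(2)[of "snd t" k N] Bkk by simp
      then show "int l dvd bform N lam f g - bform N (mut_lam N (snd t) k lam)
          (elin k (colpos N (snd t') k) f) (elin k (colpos N (snd t') k) g)"
        unfolding bform_mut_lam[of "snd t" k N lam, OF Bkk T.ex_less[OF k]] w by (simp only: elin_elin) simp
    qed simp
    then have "compatible_frame l z \<sigma> N (fst t) lam ex (snd t) D"
      using lam T.ex T.copr unfolding B' mutB_mutB by unfold_locales auto
    then show ?thesis
      using t' good_seed_def by blast
  qed
qed

lemma good_seed_exchange:
  assumes step: "qmut_dir l z \<sigma> N k t t'" and k: "k \<in> ex" and good: "good_seed N ex D t"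
  shows "snd t' = mutB k (snd t)" "\<And>j. j < N \<Longrightarrow> j \<noteq> k \<Longrightarrow> fst t' (ev j) = fst t (ev j)"
    "fst t' (ev k) ^ l * fst t (ev k) ^ l
      = fst t (scale (int l) (colpos N (snd t) k)) + fst t (scale (int l) (- colneg N (snd t) k))"
proof -
  obtain lam where lam: "toric_frame l z \<sigma> N (fst t) lam"
    and B': "snd t' = mutB k (snd t)" and j: "\<forall>j<N. j \<noteq> k \<longrightarrow> fst t' (ev j) = fst t (ev j)"
    and evk: "fst t' (ev k) = fst t (\<lambda>i. - ev k i + colpos N (snd t) k i) + fst t (\<lambda>i. - ev k i - colneg N (snd t) k i)"
    using step unfolding qmut_dir_def by blast
  interpret T: compatible_frame l z \<sigma> N "fst t" lam ex "snd t" D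
    by (rule good_seed_lam[OF good lam])
  have "fst t' (ev k) = fst t (- ev k + colpos N (snd t) k) + fst t (- ev k - colneg N (snd t) k)"
    unfolding evk by (intro arg_cong2[where f = "(+)"] arg_cong[where f = "fst t"]) (simp_all add: fun_eq_iff)
  then show "fst t' (ev k) ^ l * fst t (ev k) ^ l
      = fst t (scale (int l) (colpos N (snd t) k)) + fst t (scale (int l) (- colneg N (snd t) k))"
    by (simp only: T.exchange_power[OF k])
  show "snd t' = mutB k (snd t)" "\<And>j. j < N \<Longrightarrow> j \<noteq> k \<Longrightarrow> fst t' (ev j) = fst t (ev j)"
    using B' j by blast+
qed

end

section \<open>Rational functions of central elements\<close>

text \<open>\<open>monom_power\<close> forgets variables of index \<open>N\<close> or more, so
  injectivity of \<open>poly_power\<close> needs this restriction.\<close>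

definition poly_vars_below :: "nat \<Rightarrow> ((nat \<Rightarrow>\<^sub>0 nat) \<Rightarrow>\<^sub>0 int) \<Rightarrow> bool" where
  "poly_vars_below N p \<longleftrightarrow> (\<forall>m\<in>Poly_Mapping.keys p. Poly_Mapping.keys m \<subseteq> {..<N})"

lemma poly_vars_below_add:
  "poly_vars_below N p \<Longrightarrow> poly_vars_below N q \<Longrightarrow> poly_vars_below N (p + q)"
  using Poly_Mapping.keys_add[of p q] by (auto simp: poly_vars_below_def)

lemma poly_vars_below_minus: "poly_vars_below N p \<Longrightarrow> poly_vars_below N (- p)"
  by (simp add: poly_vars_below_def)

lemma poly_vars_below_mult:
  "poly_vars_below N p \<Longrightarrow> poly_vars_below N q \<Longrightarrow> poly_vars_below N (p * q)"
  unfolding poly_vars_below_def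
proof
  fix m assume p: "\<forall>m\<in>Poly_Mapping.keys p. Poly_Mapping.keys m \<subseteq> {..<N}"
    and q: "\<forall>m\<in>Poly_Mapping.keys q. Poly_Mapping.keys m \<subseteq> {..<N}"
    and "m \<in> Poly_Mapping.keys (p * q)"
  then obtain m1 m2 where "m = m1 + m2" "m1 \<in> Poly_Mapping.keys p" "m2 \<in> Poly_Mapping.keys q"
    using Poly_Mapping.keys_mult[of p q] by blast
  then show "Poly_Mapping.keys m \<subseteq> {..<N}"
    using p q Poly_Mapping.keys_add[of m1 m2] by blast
qed

lemma poly_vars_below_0: "poly_vars_below N 0"
  and poly_vars_below_1: "poly_vars_below N 1"
  by (auto simp: poly_vars_below_def)

context frame begin

text \<open>The product of powers of the M(e_i)^l, written as one frame element: no order of factors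
  has to be chosen, and independence of the frame applies directly.\<close>

definition monom_power :: "(nat \<Rightarrow>\<^sub>0 nat) \<Rightarrow> 'f" where
  "monom_power m = M (scale (int l) (\<lambda>i. if i < N then int (Poly_Mapping.lookup m i) else 0))"

definition poly_power :: "((nat \<Rightarrow>\<^sub>0 nat) \<Rightarrow>\<^sub>0 int) \<Rightarrow> 'f" where
  "poly_power p = (\<Sum>m\<in>Poly_Mapping.keys p. of_int (Poly_Mapping.lookup p m) * monom_power m)"

lemma expo_ZN: "(\<lambda>i. if i < N then f i else 0) \<in> ZN N"
  by (auto simp: ZN_def)

lemma monom_power_mult: "monom_power (m + m') = monom_power m * monom_power m'"
proof -
  let ?e = "\<lambda>m i. if i < N then int (Poly_Mapping.lookup m i) else 0"
  have "scale (int l) (?e (m + m')) = scale (int l) (?e m) + scale (int l) (?e m')"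
    by (auto simp: fun_eq_iff scale_apply lookup_add algebra_simps)
  then show ?thesis
    unfolding monom_power_def using M_scale_l_mult[OF expo_ZN ZN_scale[OF expo_ZN]] by simp
qed

lemma monom_power_commute: "monom_power m * y = y * monom_power m"
  unfolding monom_power_def by (rule M_scale_l_central[OF expo_ZN])

lemma poly_power_commute: "poly_power p * y = y * poly_power p"
proof -
  have "of_int c * monom_power m * y = y * (of_int c * monom_power m)" for c m
    by (metis monom_power_commute mult.assoc mult_of_int_commute)
  then show ?thesis
    by (simp add: poly_power_def sum_distrib_left sum_distrib_right)
qed

lemma poly_power_0 [simp]: "poly_power 0 = 0"
  by (simp add: poly_power_def)

lemma poly_power_single: "poly_power (Poly_Mapping.single m c) = of_int c * monom_power m"
  by (simp add: poly_power_def)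

lemma poly_power_add: "poly_power (p + q) = poly_power p + poly_power q"
  unfolding poly_power_def
  by (rule Poly_Mapping.setsum_keys_plus_distrib) (simp_all add: distrib_right)

lemma poly_power_minus: "poly_power (- p) = - poly_power p"
  using poly_power_add[of p "- p"] by (simp add: eq_neg_iff_add_eq_0 add.commute)

lemma poly_power_diff: "poly_power (p - q) = poly_power p - poly_power q"
  using poly_power_add[of p "- q"] by (simp add: poly_power_minus)

lemma poly_power_mult: "poly_power (p * q) = poly_power p * poly_power q"
proof -
  \<comment> \<open>Integer polynomials form the free abelian group on the monomials, so additivity
    reduces each factor to a single monomial.\<close>
  have 1: "poly_power (Poly_Mapping.single m 1 * q) = monom_power m * poly_power q" for m
  proof (rule frag_induction[of q UNIV])
    show "poly_power (Poly_Mapping.single m 1 * Poly_Mapping.single n 1)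
        = monom_power m * poly_power (Poly_Mapping.single n 1)" for n
      by (simp add: Poly_Mapping.mult_single poly_power_single monom_power_mult)
  qed (simp_all add: right_diff_distrib poly_power_diff)
  show ?thesis
    by (rule frag_induction[of p UNIV])
      (simp_all add: 1 poly_power_single left_diff_distrib poly_power_diff)
qed

lemma poly_power_1: "poly_power 1 = 1"
proof -
  have "poly_power 1 = monom_power 0"
    using poly_power_single[of 0 1] by simp
  also have "\<dots> = M 0"
    unfolding monom_power_def by (rule arg_cong[where f = M]) (simp add: fun_eq_iff scale_apply)
  finally show ?thesis
    by simp
qed

text \<open>Scaling by \<open>l > 0\<close> keeps the exponents of distinct monomials distinct, and
  integer coefficients lie in Z[zeta].\<close>

lemma poly_power_eq_0:
  assumes "poly_vars_below N p" "poly_power p = 0"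
  shows "p = 0"
proof (rule ccontr)
  assume "p \<noteq> 0"
  then obtain m where m: "m \<in> Poly_Mapping.keys p"
    using Poly_Mapping.keys_eq_empty by blast
  let ?h = "\<lambda>m. scale (int l) (\<lambda>i. if i < N then int (Poly_Mapping.lookup m i) else 0)"
  have "inj_on ?h (Poly_Mapping.keys p)"
  proof (rule inj_onI)
    fix m m' assume mm: "m \<in> Poly_Mapping.keys p" "m' \<in> Poly_Mapping.keys p" "?h m = ?h m'"
    have "Poly_Mapping.lookup m i = Poly_Mapping.lookup m' i" for i
    proof (cases "i < N")
      case True
      then show ?thesis
        using fun_cong[OF mm(3), of i] l_pos by (simp add: scale_apply)
    next
      case False
      then have "i \<notin> Poly_Mapping.keys m" "i \<notin> Poly_Mapping.keys m'"
        using assms(1) mm unfolding poly_vars_below_def by blast+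
      then show ?thesis
        by (simp add: Poly_Mapping.in_keys_iff)
    qed
    then show "m = m'"
      by (rule Poly_Mapping.poly_mapping_eqI)
  qed
  moreover have "(\<Sum>m\<in>Poly_Mapping.keys p. \<sigma> (of_int (Poly_Mapping.lookup p m)) * M (?h m)) = 0"
    using assms(2) by (simp add: poly_power_def monom_power_def \<sigma>_of_int)
  ultimately have "(of_int (Poly_Mapping.lookup p m) :: complex) = 0"
    using m by (intro M_independent[where c = "\<lambda>m. of_int (Poly_Mapping.lookup p m)" and i = m])
      (auto intro: ring_gen_of_int ZN_scale expo_ZN)
  then show False
    using m by (simp add: Poly_Mapping.in_keys_iff)
qed

text \<open>The graph of the embedding of \<open>\<rat>(x\<^sub>0, \<dots>, x\<^sub>N\<^sub>-\<^sub>1)\<close> into the centre that sends \<open>x\<^sub>i\<close> to \<open>M(e\<^sub>i)\<^sup>l\<close>;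
  the type of rational functions has infinitely many variables, so this is only a partial map.\<close>

definition Phi :: "ratfun \<Rightarrow> 'f \<Rightarrow> bool" where
  "Phi q y \<longleftrightarrow> (\<exists>a b. poly_vars_below N a \<and> poly_vars_below N b \<and> b \<noteq> 0 \<and> q = Fract a b \<and>
     y * poly_power b = poly_power a)"

lemma Phi_E:
  assumes "Phi q y"
  obtains a b where "poly_vars_below N a" "poly_vars_below N b" "b \<noteq> 0" "q = Fract a b"
    "y * poly_power b = poly_power a" "poly_power b \<noteq> 0"
  using assms poly_power_eq_0 unfolding Phi_def by blast

text \<open>Cross-multiplication, with centrality and injectivity of \<open>poly_power\<close>,
  compares both equalities. One direction makes \<open>Phi\<close> single-valued, the other
  injective.\<close>

lemma Phi_eq_iff:
  assumes "Phi q y" "Phi q' y'"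
  shows "q = q' \<longleftrightarrow> y = y'"
proof -
  from assms obtain a b c d where ab: "poly_vars_below N a" "poly_vars_below N b" "b \<noteq> 0" "q = Fract a b"
      "y * poly_power b = poly_power a" "poly_power b \<noteq> 0"
    and cd: "poly_vars_below N c" "poly_vars_below N d" "d \<noteq> 0" "q' = Fract c d"
      "y' * poly_power d = poly_power c" "poly_power d \<noteq> 0"
    by (metis Phi_E)
  have "poly_vars_below N (a * d + - (c * b))"
    using ab cd by (intro poly_vars_below_add poly_vars_below_mult poly_vars_below_minus)
  then have "q = q' \<longleftrightarrow> poly_power (a * d + - (c * b)) = 0"
    using ab cd poly_power_eq_0[of "a * d + - (c * b)"] by (auto simp: eq_fract)
  also have "\<dots> \<longleftrightarrow> poly_power a * poly_power d = poly_power c * poly_power b"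
    by (simp add: poly_power_diff poly_power_mult)
  also have "\<dots> \<longleftrightarrow> y * (poly_power b * poly_power d) = y' * (poly_power b * poly_power d)"
    using poly_power_commute[of d "poly_power b"] ab(5) cd(5) by (metis mult.assoc)
  also have "\<dots> \<longleftrightarrow> y = y'"
    using ab cd by simp
  finally show ?thesis .
qed

lemma Phi_add:
  assumes "Phi q y" "Phi q' y'"
  shows "Phi (q + q') (y + y')"
proof -
  from assms obtain a b c d where ab: "poly_vars_below N a" "poly_vars_below N b" "b \<noteq> 0" "q = Fract a b"
      "y * poly_power b = poly_power a"
    and cd: "poly_vars_below N c" "poly_vars_below N d" "d \<noteq> 0" "q' = Fract c d"
      "y' * poly_power d = poly_power c"
    by (metis Phi_E)
  have "(y + y') * poly_power (b * d) = (y * poly_power b) * poly_power d + (y' * poly_power d) * poly_power b"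
    using poly_power_commute[of d "poly_power b"] by (simp add: poly_power_mult distrib_right mult.assoc)
  also have "\<dots> = poly_power (a * d + c * b)"
    unfolding ab cd by (simp add: poly_power_add poly_power_mult)
  finally show ?thesis
    unfolding Phi_def using ab cd
    by (intro exI[of _ "a * d + c * b"] exI[of _ "b * d"])
      (simp add: poly_vars_below_add poly_vars_below_mult)
qed

lemma Phi_mult:
  assumes "Phi q y" "Phi q' y'"
  shows "Phi (q * q') (y * y')"
proof -
  from assms obtain a b c d where ab: "poly_vars_below N a" "poly_vars_below N b" "b \<noteq> 0" "q = Fract a b"
      "y * poly_power b = poly_power a"
    and cd: "poly_vars_below N c" "poly_vars_below N d" "d \<noteq> 0" "q' = Fract c d"
      "y' * poly_power d = poly_power c"
    by (metis Phi_E)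
  have "(y * y') * poly_power (b * d) = y * (poly_power b * y') * poly_power d"
    using poly_power_commute[of b y'] by (simp add: poly_power_mult mult.assoc[symmetric])
  also have "\<dots> = (y * poly_power b) * (y' * poly_power d)"
    by (simp only: mult.assoc)
  also have "\<dots> = poly_power (a * c)"
    unfolding ab cd by (simp add: poly_power_mult)
  finally show ?thesis
    unfolding Phi_def using ab cd
    by (intro exI[of _ "a * c"] exI[of _ "b * d"]) (simp add: poly_vars_below_mult)
qed

lemma Phi_poly: "poly_vars_below N p \<Longrightarrow> Phi (Fract p 1) (poly_power p)"
  unfolding Phi_def using poly_vars_below_1 poly_power_1
  by (intro exI[of _ p] exI[of _ 1]) auto

lemma Phi_0: "Phi 0 0" and Phi_1: "Phi 1 1"
  using Phi_poly[OF poly_vars_below_0] Phi_poly[OF poly_vars_below_1]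
  by (simp_all add: Zero_fract_def One_fract_def poly_power_1)

lemma Phi_minus: "Phi q y \<Longrightarrow> Phi (- q) (- y)"
  using Phi_mult[OF _ Phi_poly[OF poly_vars_below_minus[OF poly_vars_below_1]], of q y]
  by (simp add: poly_power_minus poly_power_1 One_fract_def[symmetric] minus_fract[symmetric] del: minus_fract)

lemma Phi_inverse:
  assumes "Phi q y"
  shows "Phi (inverse q) (inverse y)"
proof (cases "y = 0")
  \<comment> \<open>By convention both inverses are then 0.\<close>
  case True
  then have "q = 0"
    using Phi_eq_iff[OF assms Phi_0] by simp
  then show ?thesis
    using True Phi_0 by simp
next
  case False
  from assms obtain a b where ab: "poly_vars_below N a" "poly_vars_below N b" "b \<noteq> 0" "q = Fract a b"
      "y * poly_power b = poly_power a" "poly_power b \<noteq> 0"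
    by (metis Phi_E)
  have "a \<noteq> 0"
    using ab False by auto
  moreover have "inverse y * poly_power a = poly_power b"
    using False by (simp add: ab(5)[symmetric] mult.assoc[symmetric])
  ultimately show ?thesis
    unfolding Phi_def using ab by (intro exI[of _ b] exI[of _ a]) auto
qed

lemma Phi_power: "Phi q y \<Longrightarrow> Phi (q ^ n) (y ^ n)"
  by (induction n) (auto intro: Phi_1 Phi_mult)

lemma Phi_xvar:
  assumes "i < N"
  shows "Phi (xvar i) (M (ev i) ^ l)"
proof -
  let ?p = "Poly_Mapping.single (Poly_Mapping.single i 1) 1 :: (nat \<Rightarrow>\<^sub>0 nat) \<Rightarrow>\<^sub>0 int"
  have "poly_power ?p = M (scale (int l) (ev i))"
    unfolding poly_power_single monom_power_def using assms
    by (auto simp: fun_eq_iff scale_apply ev_apply lookup_single when_def intro!: arg_cong[where f = M])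
  moreover have "poly_vars_below N ?p"
    using assms by (simp add: poly_vars_below_def)
  ultimately show ?thesis
    using Phi_poly[of ?p] assms by (simp add: xvar_def M_power ZN_ev)
qed

lemma Phi_ring_gen:
  assumes "\<And>y. y \<in> S \<Longrightarrow> \<exists>q\<in>T. Phi q y" "y \<in> ring_gen S"
  shows "\<exists>q\<in>ring_gen T. Phi q y"
  using assms(2)
proof induction
  case (rg_base y)
  then show ?case using assms(1) ring_gen.rg_base by blast
qed (blast intro: ring_gen.intros Phi_1 Phi_add Phi_minus Phi_mult)+

lemma Phi_ring_gen':
  assumes "\<And>q. q \<in> T \<Longrightarrow> \<exists>y\<in>S. Phi q y" "q \<in> ring_gen T"
  shows "\<exists>y\<in>ring_gen S. Phi q y"
  using assms(2)
proof induction
  case (rg_base y)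
  then show ?case using assms(1) ring_gen.rg_base by blast
qed (blast intro: ring_gen.intros Phi_1 Phi_add Phi_minus Phi_mult)+

text \<open>Matching of generators spreads to the generated rings by closure under the ring
  operations; \<open>Phi_eq_iff\<close> then turns the relation into a bijective map.\<close>

lemma ring_isomorphic_Phi:
  assumes ST: "\<And>y. y \<in> S \<Longrightarrow> \<exists>q\<in>T. Phi q y" and TS: "\<And>q. q \<in> T \<Longrightarrow> \<exists>y\<in>S. Phi q y"
  shows "ring_isomorphic (ring_gen S) (ring_gen T)"
proof -
  have "\<forall>y\<in>ring_gen S. \<exists>q. q \<in> ring_gen T \<and> Phi q y"
    using Phi_ring_gen[OF ST] by blast
  then obtain h where h: "\<And>y. y \<in> ring_gen S \<Longrightarrow> h y \<in> ring_gen T \<and> Phi (h y) y"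
    by metis
  have h_eq: "h y = q" if "y \<in> ring_gen S" "Phi q y" for y q
    using Phi_eq_iff h that by blast
  have "bij_betw h (ring_gen S) (ring_gen T)"
  proof (rule bij_betw_imageI)
    show "inj_on h (ring_gen S)"
      by (rule inj_onI) (metis h Phi_eq_iff)
    show "h ` ring_gen S = ring_gen T"
      using h Phi_ring_gen'[OF TS] h_eq by blast
  qed
  moreover have "h 1 = 1"
    by (rule h_eq[OF rg_one Phi_1])
  moreover have "h (a + b) = h a + h b \<and> h (a * b) = h a * h b"
    if "a \<in> ring_gen S" "b \<in> ring_gen S" for a b
    using that h by (intro conjI h_eq rg_add rg_mult Phi_add Phi_mult) auto
  ultimately show ?thesis
    unfolding ring_isomorphic_def by blast
qed

end

section \<open>The classical mutations\<close>

text \<open>Indices of the wrong sign get exponent 0, so that the exponents are the vectors of the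
  quantum exchange relation.\<close>

definition exchange_poly :: "nat \<Rightarrow> (nat \<Rightarrow> nat \<Rightarrow> int) \<Rightarrow> nat \<Rightarrow> (nat \<Rightarrow> 'a::comm_ring_1) \<Rightarrow> 'a" where
  "exchange_poly N B k x = (\<Prod>i<N. x i ^ nat (colpos N B k i)) + (\<Prod>i<N. x i ^ nat (- colneg N B k i))"

definition cmutate :: "nat \<Rightarrow> nat \<Rightarrow> (nat \<Rightarrow> ratfun) \<times> (nat \<Rightarrow> nat \<Rightarrow> int) \<Rightarrow>
    (nat \<Rightarrow> ratfun) \<times> (nat \<Rightarrow> nat \<Rightarrow> int)" where
  "cmutate N k c = ((fst c)(k := exchange_poly N (snd c) k (fst c) / fst c k), mutB k (snd c))"

lemma cmut_step_iff: "cmut_step N ex c c' \<longleftrightarrow> (\<exists>k\<in>ex. c' = cmutate N k c)"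
proof -
  have 1: "(\<Prod>i\<in>{i. i < N \<and> B i k > 0}. x i ^ nat (B i k)) = (\<Prod>i<N. x i ^ nat (colpos N B k i))"
    for B :: "nat \<Rightarrow> nat \<Rightarrow> int" and k and x :: "nat \<Rightarrow> ratfun"
    by (rule prod.mono_neutral_cong_left) (auto simp: colpos_def le_less)
  have 2: "(\<Prod>i\<in>{i. i < N \<and> B i k < 0}. x i ^ nat (- B i k)) = (\<Prod>i<N. x i ^ nat (- colneg N B k i))"
    for B :: "nat \<Rightarrow> nat \<Rightarrow> int" and k and x :: "nat \<Rightarrow> ratfun"
    by (rule prod.mono_neutral_cong_left) (auto simp: colneg_def le_less)
  show ?thesis
    unfolding cmut_step_def cmutate_def exchange_poly_def prod_eq_iff 1 2 by simp
qed

lemma colpos_mutB: "colpos N (mutB k B) k = - colneg N B k"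
  and colneg_mutB: "colneg N (mutB k B) k = - colpos N B k"
  by (auto simp: fun_eq_iff colpos_def colneg_def mutB_def)

text \<open>As b_kk = 0, the exchange polynomial does not contain x_k, and negating column
  \<open>k\<close> only swaps its two products.\<close>

lemma cmutate_cmutate:
  assumes "snd c k k = 0" "fst (cmutate N k c) k \<noteq> 0"
  shows "cmutate N k (cmutate N k c) = c"
proof -
  let ?B = "snd c" and ?x = "fst c"
  have diag: "colpos N ?B k k = 0" "colneg N ?B k k = 0"
    using colpos_colneg_diag(1,2)[of ?B k N] assms(1) by auto
  have upd: "(\<Prod>i<N. (?x(k := y)) i ^ nat (f i)) = (\<Prod>i<N. ?x i ^ nat (f i))" if "f k = 0" for y f
    using that by (intro prod.cong) auto
  have P: "exchange_poly N (mutB k ?B) k (?x(k := y)) = exchange_poly N ?B k ?x" for y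
  proof -
    have "exchange_poly N (mutB k ?B) k (?x(k := y))
      = (\<Prod>i<N. (?x(k := y)) i ^ nat (- colneg N ?B k i)) + (\<Prod>i<N. (?x(k := y)) i ^ nat (colpos N ?B k i))"
      by (simp add: exchange_poly_def colpos_mutB colneg_mutB)
    also have "\<dots> = exchange_poly N ?B k ?x"
      using diag upd[of "\<lambda>i. - colneg N ?B k i"] upd[of "colpos N ?B k"]
      by (simp add: exchange_poly_def add.commute)
    finally show ?thesis .
  qed
  \<comment> \<open>Division by 0 gives 0, so a nonzero new variable excludes a zero numerator and a
    zero denominator.\<close>
  have "exchange_poly N ?B k ?x \<noteq> 0" "?x k \<noteq> 0"
    using assms(2) by (auto simp: cmutate_def)
  then show ?thesis
    by (simp add: cmutate_def P mutB_mutB prod_eq_iff)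
qed

section \<open>Comparison of the two mutation classes\<close>

text \<open>\<open>Phi\<close> belongs to the fixed frame, \<open>Mt\<close> may be a mutated one.
  Matching is demanded only at nonzero exponents, since for a backward step it is known only away
  from \<open>k\<close>.\<close>

lemma (in frame) Phi_monomial:
  assumes "frame l z \<sigma> N Mt lamt" "f \<in> ZN N" "\<And>i. 0 \<le> f i"
    and x: "\<And>i. i < N \<Longrightarrow> f i \<noteq> 0 \<Longrightarrow> Phi (x i) (Mt (ev i) ^ l)"
  shows "Phi (\<Prod>i<N. x i ^ nat (f i)) (Mt (scale (int l) f))"
proof -
  interpret T: frame l z \<sigma> N Mt lamt by fact
  let ?f = "\<lambda>n i. if i < n then f i else 0"
  have f: "?f n \<in> ZN N" for n
    using assms(2) by (auto simp: ZN_def)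
  have "n \<le> N \<Longrightarrow> Phi (\<Prod>i<n. x i ^ nat (f i)) (Mt (scale (int l) (?f n)))" for n
  proof (induction n)
    case 0
    have "scale (int l) (?f 0) = 0"
      by (simp add: fun_eq_iff scale_apply)
    then show ?case
      by (simp only: T.M_0 lessThan_0 prod.empty Phi_1)
  next
    case (Suc n)
    let ?e = "scale (f n) (ev n)"
    have e: "?e \<in> ZN N"
      using Suc.prems by (intro ZN_scale ZN_ev) simp
    have "Phi (x n ^ nat (f n)) (Mt (scale (int l) ?e))"
    proof -
      have "(Mt (ev n) ^ l) ^ nat (f n) = Mt (scale (int (nat (f n))) (scale (int l) (ev n)))"
        using Suc.prems by (simp only: T.M_power ZN_ev ZN_scale Suc_le_eq)
      also have "scale (int (nat (f n))) (scale (int l) (ev n)) = scale (int l) ?e"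
        using assms(3)[of n] by (simp add: fun_eq_iff scale_apply)
      finally have "Phi (x n ^ nat (f n)) (Mt (scale (int l) ?e))" if "f n \<noteq> 0"
        using Phi_power[OF x[of n], of "nat (f n)"] Suc.prems that by simp
      moreover have "Phi (x n ^ nat (f n)) (Mt (scale (int l) ?e))" if "f n = 0"
        unfolding that scale_0 scale_zero using Phi_1 by simp
      ultimately show ?thesis
        by blast
    qed
    then have "Phi ((\<Prod>i<n. x i ^ nat (f i)) * x n ^ nat (f n)) (Mt (scale (int l) (?f n)) * Mt (scale (int l) ?e))"
      using Suc by (intro Phi_mult) auto
    also have "Mt (scale (int l) (?f n)) * Mt (scale (int l) ?e) = Mt (scale (int l) (?f n) + scale (int l) ?e)"
      by (rule T.M_scale_l_mult[OF f ZN_scale[OF e]])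
    also have "scale (int l) (?f n) + scale (int l) ?e = scale (int l) (?f (Suc n))"
      by (auto simp: fun_eq_iff scale_apply ev_apply less_Suc_eq)
    finally show ?case
      by simp
  qed
  from this[OF order_refl] have "Phi (\<Prod>i<N. x i ^ nat (f i)) (Mt (scale (int l) (?f N)))" .
  moreover have "?f N = f"
    using assms(2) by (auto simp: fun_eq_iff ZN_def)
  ultimately show ?thesis
    by (simp only:)
qed

context compatible_frame begin

text \<open>The last condition keeps frozen frame elements fixed, so the inverses coming from
  \<open>Inv\<close> are those of the initial seed.\<close>

definition corr :: "((nat \<Rightarrow> int) \<Rightarrow> 'f) \<times> (nat \<Rightarrow> nat \<Rightarrow> int) \<Rightarrow> (nat \<Rightarrow> ratfun) \<times> (nat \<Rightarrow> nat \<Rightarrow> int) \<Rightarrow> bool" where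
  "corr t c \<longleftrightarrow> good_seed N ex D t \<and> snd t = snd c \<and> (\<forall>i<N. Phi (fst c i) (fst t (ev i) ^ l)) \<and>
     (\<forall>i. i \<notin> ex \<longrightarrow> fst c i = xvar i) \<and> (\<forall>j<N. j \<notin> ex \<longrightarrow> fst t (ev j) = M (ev j))"

lemma corr_initial: "corr (M, B) (xvar, B)"
  unfolding corr_def good_seed_def using Phi_xvar compatible_frame_axioms by auto

lemma corr_nonzero:
  assumes "corr t c" "i < N"
  shows "fst c i \<noteq> 0" "fst t (ev i) \<noteq> 0"
proof -
  obtain lamt where "compatible_frame l z \<sigma> N (fst t) lamt ex (snd t) D"
    using assms(1) unfolding corr_def good_seed_def by blast
  then interpret T: compatible_frame l z \<sigma> N "fst t" lamt ex "snd t" D .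
  show t: "fst t (ev i) \<noteq> 0"
    using assms(2) by (intro T.M_nonzero ZN_ev)
  have "Phi (fst c i) (fst t (ev i) ^ l)"
    using assms by (simp add: corr_def)
  then show "fst c i \<noteq> 0"
    using Phi_eq_iff[OF _ Phi_0] t by auto
qed

lemma corr_mutate:
  assumes tc: "corr t c" and k: "k \<in> ex" and t': "good_seed N ex D t'" "snd t' = mutB k (snd t)"
    and j: "\<And>j. j < N \<Longrightarrow> j \<noteq> k \<Longrightarrow> fst t' (ev j) = fst t (ev j)"
    and p: "fst t' (ev k) ^ l * fst t (ev k) ^ l = p" "Phi (exchange_poly N (snd c) k (fst c)) p"
  shows "corr t' (cmutate N k c)"
proof -
  have kN: "k < N" using ex_less[OF k] .
  let ?y = "fst t (ev k) ^ l"
  have y: "?y \<noteq> 0"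
    using corr_nonzero[OF tc kN] by simp
  have "fst t' (ev k) ^ l = p * inverse ?y"
    using y by (simp add: p(1)[symmetric] mult.assoc)
  moreover have "Phi (exchange_poly N (snd c) k (fst c) / fst c k) (p * inverse ?y)"
    unfolding divide_inverse using tc kN by (intro Phi_mult p Phi_inverse) (auto simp: corr_def)
  ultimately have "Phi (fst (cmutate N k c) k) (fst t' (ev k) ^ l)"
    by (simp add: cmutate_def)
  moreover have "Phi (fst (cmutate N k c) i) (fst t' (ev i) ^ l)" if "i < N" "i \<noteq> k" for i
    using that tc j by (simp add: cmutate_def corr_def)
  ultimately have "\<forall>i<N. Phi (fst (cmutate N k c) i) (fst t' (ev i) ^ l)"
    by blast
  moreover have "\<forall>i. i \<notin> ex \<longrightarrow> fst (cmutate N k c) i = xvar i"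
    using tc k by (auto simp: corr_def cmutate_def)
  moreover have "\<forall>i<N. i \<notin> ex \<longrightarrow> fst t' (ev i) = M (ev i)"
    using tc k j unfolding corr_def by metis
  moreover have "snd t' = snd (cmutate N k c)"
    using tc t' by (simp add: corr_def cmutate_def)
  ultimately show ?thesis
    using t' unfolding corr_def by blast
qed

text \<open>Whichever way the quantum step runs, the classical side mutates forwards: the exchange
  relation is shared by both seeds, as mutation only swaps the two parts of column
  \<open>k\<close>.\<close>

lemma corr_step:
  assumes tc: "corr t c" and k: "k \<in> ex"
    and step: "qmut_dir l z \<sigma> N k t t' \<or> qmut_dir l z \<sigma> N k t' t"
  shows "corr t' (cmutate N k c)"
proof -
  have t: "good_seed N ex D t" and B: "snd t = snd c"
    and Phi: "\<And>i. i < N \<Longrightarrow> Phi (fst c i) (fst t (ev i) ^ l)"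
    using tc by (auto simp: corr_def)
  have t': "good_seed N ex D t'"
    using step good_seed_step t k unfolding qmut_step_iff by blast
  obtain lamt where "compatible_frame l z \<sigma> N (fst t) lamt ex (snd t) D"
    using t unfolding good_seed_def by blast
  then interpret T: compatible_frame l z \<sigma> N "fst t" lamt ex "snd t" D .
  obtain lamt' where "compatible_frame l z \<sigma> N (fst t') lamt' ex (snd t') D"
    using t' unfolding good_seed_def by blast
  then interpret T': compatible_frame l z \<sigma> N "fst t'" lamt' ex "snd t'" D .
  have nonneg: "0 \<le> colpos N B k i" "0 \<le> (- colneg N B k) i" for B k i
    by (auto simp: colpos_def colneg_def)
  have ZN: "colpos N B k \<in> ZN N" "- colneg N B k \<in> ZN N" for B k
    by (auto intro: ZN_minus)
  from step show ?thesis
  proof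
    assume "qmut_dir l z \<sigma> N k t t'"
    note ex = good_seed_exchange[OF this k t]
    have "Phi (\<Prod>i<N. fst c i ^ nat (colpos N (snd t) k i)) (fst t (scale (int l) (colpos N (snd t) k)))"
      by (rule Phi_monomial[OF T.frame_axioms ZN(1) nonneg(1) Phi])
    moreover have "Phi (\<Prod>i<N. fst c i ^ nat ((- colneg N (snd t) k) i)) (fst t (scale (int l) (- colneg N (snd t) k)))"
      by (rule Phi_monomial[OF T.frame_axioms ZN(2) nonneg(2) Phi])
    ultimately have "Phi (exchange_poly N (snd c) k (fst c))
        (fst t (scale (int l) (colpos N (snd t) k)) + fst t (scale (int l) (- colneg N (snd t) k)))"
      unfolding exchange_poly_def B[symmetric] using Phi_add by simp
    then show ?thesis
      using corr_mutate[OF tc k t' ex(1) _ ex(3)] ex(2) by blast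
  next
    assume "qmut_dir l z \<sigma> N k t' t"
    note ex = good_seed_exchange[OF this k t']
    have B': "snd t' = mutB k (snd t)"
      by (simp add: ex(1) mutB_mutB)
    have diag: "colpos N (snd t) k k = 0" "(- colneg N (snd t) k) k = 0"
      using colpos_colneg_diag(1,2)[of "snd t" k N] T.B_diag[OF k] by auto
    \<comment> \<open>The exchange monomials avoid index \<open>k\<close>, and elsewhere the
      variables of \<open>t\<close> and \<open>t'\<close> coincide.\<close>
    have Phi': "Phi (fst c i) (fst t' (ev i) ^ l)" if "i < N" "i \<noteq> k" for i
      using Phi[OF that(1)] ex(2)[OF that] by simp
    \<comment> \<open>Centrality of l-th powers lets the relation of \<open>t'\<close> be read from
      the side of \<open>t\<close>.\<close>
    have "fst t' (ev k) ^ l * fst t (ev k) ^ l = fst t (ev k) ^ l * fst t' (ev k) ^ l"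
      using ex_less[OF k] by (intro T'.M_power_l_central ZN_ev)
    also have "\<dots> = fst t' (scale (int l) (colpos N (snd t) k)) + fst t' (scale (int l) (- colneg N (snd t) k))"
      unfolding ex(3) B' colpos_mutB colneg_mutB by (simp add: add.commute)
    finally have p': "fst t' (ev k) ^ l * fst t (ev k) ^ l
      = fst t' (scale (int l) (colpos N (snd t) k)) + fst t' (scale (int l) (- colneg N (snd t) k))" .
    have "Phi (\<Prod>i<N. fst c i ^ nat (colpos N (snd t) k i)) (fst t' (scale (int l) (colpos N (snd t) k)))"
      by (rule Phi_monomial[OF T'.frame_axioms ZN(1) nonneg(1)]) (use diag Phi' in metis)
    moreover have "Phi (\<Prod>i<N. fst c i ^ nat ((- colneg N (snd t) k) i)) (fst t' (scale (int l) (- colneg N (snd t) k)))"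
      by (rule Phi_monomial[OF T'.frame_axioms ZN(2) nonneg(2)]) (use diag Phi' in metis)
    ultimately have "Phi (exchange_poly N (snd c) k (fst c))
        (fst t' (scale (int l) (colpos N (snd t) k)) + fst t' (scale (int l) (- colneg N (snd t) k)))"
      unfolding exchange_poly_def B[symmetric] using Phi_add by simp
    then show ?thesis
      using corr_mutate[OF tc k t' B' _ p'] ex(2)[symmetric] by blast
  qed
qed

lemma quantum_to_classical:
  assumes "qmut_equiv l z \<sigma> N ex (M, B) t"
  shows "\<exists>c. equivclp (cmut_step N ex) (xvar, B) c \<and> corr t c"
  using assms unfolding qmut_equiv_def
proof (induction rule: equivclp_induct)
  case base
  show ?case by (intro exI[of _ "(xvar, B)"] conjI equivclp_refl corr_initial)
next
  case (step t t')
  then obtain c where c: "equivclp (cmut_step N ex) (xvar, B) c" "corr t c"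
    by blast
  obtain k where "k \<in> ex" "corr t' (cmutate N k c)"
    using corr_step[OF c(2)] step(2) unfolding qmut_step_iff by blast
  moreover from this have "cmut_step N ex c (cmutate N k c)"
    by (auto simp: cmut_step_iff)
  ultimately show ?case
    using c(1) equivclp_into_equivclp by metis
qed

lemma classical_to_quantum:
  assumes "equivclp (cmut_step N ex) (xvar, B) c"
  shows "\<exists>t. qmut_equiv l z \<sigma> N ex (M, B) t \<and> corr t c"
  using assms
proof (induction rule: equivclp_induct)
  case base
  show ?case unfolding qmut_equiv_def by (intro exI[of _ "(M, B)"] conjI equivclp_refl corr_initial)
next
  case (step c c')
  then obtain t where t: "qmut_equiv l z \<sigma> N ex (M, B) t" "corr t c"
    by blast
  have good: "good_seed N ex D t" "snd t = snd c"
    using t(2) by (auto simp: corr_def)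
  obtain lamt where "compatible_frame l z \<sigma> N (fst t) lamt ex (snd t) D"
    using good unfolding good_seed_def by blast
  then interpret T: compatible_frame l z \<sigma> N "fst t" lamt ex "snd t" D .
  \<comment> \<open>A backward classical step is also a forward one: variables corresponding to
    frame elements are nonzero, so mutation is an involution here.\<close>
  obtain k where k: "k \<in> ex" "c' = cmutate N k c"
  proof -
    from step(2) consider k where "k \<in> ex" "c' = cmutate N k c" | k where "k \<in> ex" "c = cmutate N k c'"
      by (auto simp: cmut_step_iff)
    then show ?thesis
    proof cases
      case 2
      have "snd c' k k = 0"
        using T.B_diag[OF 2(1)] unfolding good(2) 2(2) by (simp add: cmutate_def mutB_def)
      moreover have "fst (cmutate N k c') k \<noteq> 0"
        using corr_nonzero(1)[OF t(2) ex_less[OF 2(1)]] 2(2) by simp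
      ultimately have "cmutate N k (cmutate N k c') = c'"
        by (rule cmutate_cmutate)
      then show ?thesis
        using that 2 by metis
    qed (use that in blast)
  qed
  obtain M' where M': "qmut_dir l z \<sigma> N k t (M', mutB k (snd t))"
    using T.ex_mutation[OF k(1)] by auto
  then have "qmut_step l z \<sigma> N ex t (M', mutB k (snd t))"
    using k(1) qmut_step_iff by blast
  then have "qmut_equiv l z \<sigma> N ex (M, B) (M', mutB k (snd t))"
    using t(1) unfolding qmut_equiv_def by (metis equivclp_into_equivclp)
  moreover have "corr (M', mutB k (snd t)) c'"
    unfolding k(2) using corr_step[OF t(2) k(1)] M' by blast
  ultimately show ?case
    by blast
qed

end

theorem theorem4p6:
  fixes l N :: nat and z :: complex and \<sigma> :: "complex \<Rightarrow> 'f::division_ring"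
    and ex Inv :: "nat set" and M :: "(nat \<Rightarrow> int) \<Rightarrow> 'f" and B :: "nat \<Rightarrow> nat \<Rightarrow> int"
  assumes "0 < l"
    and "primitive_root l z"
    and "Qz_algebra z \<sigma>"
    and "ex \<subseteq> {..<N}"
    and "Inv \<subseteq> {..<N} - ex"
    and "coprime_seed l z \<sigma> N ex M B"
  shows "ring_isomorphic (Cring l z \<sigma> N ex Inv M B) (cluster_algebra N ex Inv B)"
proof -
  obtain lam D where "toric_frame l z \<sigma> N M lam" "l_compatible l N ex lam B D" "odd l"
    "\<forall>k\<in>ex. coprime (int l) (D k)"
    using assms(6) unfolding coprime_seed_def by blast
  then interpret compatible_frame l z \<sigma> N M lam ex B D
    using assms by unfold_locales auto
  have Inv: "j < N" "j \<notin> ex" if "j \<in> Inv" for j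
    using that assms(5) by auto
  show ?thesis
    unfolding Cring_def cluster_algebra_def
  proof (rule ring_isomorphic_Phi)
    fix y
    assume "y \<in> {fst t (ev i) ^ l | t i. qmut_equiv l z \<sigma> N ex (M, B) t \<and>
          quantum_seed l z \<sigma> N ex (fst t) (snd t) \<and> i < N} \<union>
      {inverse (fst t (ev j)) ^ l | t j. qmut_equiv l z \<sigma> N ex (M, B) t \<and>
          quantum_seed l z \<sigma> N ex (fst t) (snd t) \<and> j \<in> Inv}"
    then consider t i where "y = fst t (ev i) ^ l" "qmut_equiv l z \<sigma> N ex (M, B) t" "i < N"
      | t j where "y = inverse (fst t (ev j)) ^ l" "qmut_equiv l z \<sigma> N ex (M, B) t" "j \<in> Inv"
      by blast
    then show "\<exists>q\<in>{fst c i | c i. equivclp (cmut_step N ex) (xvar, B) c \<and> i < N} \<union>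
        {inverse (xvar j) | j. j \<in> Inv}. Phi q y"
    proof cases
      case 1
      then obtain c where "equivclp (cmut_step N ex) (xvar, B) c" "corr t c"
        using quantum_to_classical by blast
      with 1 show ?thesis
        unfolding corr_def by blast
    next
      case 2
      then obtain c where "corr t c"
        using quantum_to_classical by blast
      then have "y = inverse (M (ev j) ^ l)"
        using 2 Inv by (simp add: corr_def power_inverse)
      then have "Phi (inverse (xvar j)) y"
        using Inv[OF 2(3)] by (simp add: Phi_inverse Phi_xvar)
      with 2 show ?thesis
        by blast
    qed
  next
    fix q
    assume "q \<in> {fst c i | c i. equivclp (cmut_step N ex) (xvar, B) c \<and> i < N} \<union>
        {inverse (xvar j) | j. j \<in> Inv}"
    then consider c i where "q = fst c i" "equivclp (cmut_step N ex) (xvar, B) c" "i < N"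
      | j where "q = inverse (xvar j)" "j \<in> Inv"
      by blast
    then show "\<exists>y\<in>{fst t (ev i) ^ l | t i. qmut_equiv l z \<sigma> N ex (M, B) t \<and>
          quantum_seed l z \<sigma> N ex (fst t) (snd t) \<and> i < N} \<union>
      {inverse (fst t (ev j)) ^ l | t j. qmut_equiv l z \<sigma> N ex (M, B) t \<and>
          quantum_seed l z \<sigma> N ex (fst t) (snd t) \<and> j \<in> Inv}. Phi q y"
    proof cases
      case 1
      then obtain t where t: "qmut_equiv l z \<sigma> N ex (M, B) t" "corr t c"
        using classical_to_quantum by blast
      then have "quantum_seed l z \<sigma> N ex (fst t) (snd t)" "Phi q (fst t (ev i) ^ l)"
        using 1 good_seed_quantum_seed unfolding corr_def by blast+
      with 1 t show ?thesis
        by blast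
    next
      case 2
      have "qmut_equiv l z \<sigma> N ex (M, B) (M, B)"
        by (simp add: qmut_equiv_def)
      moreover have "quantum_seed l z \<sigma> N ex (fst (M, B)) (snd (M, B))"
        using corr_initial good_seed_quantum_seed unfolding corr_def by blast
      moreover have "Phi q (inverse (fst (M, B) (ev j)) ^ l)"
        using 2 Inv[OF 2(2)] by (simp add: power_inverse Phi_inverse Phi_xvar)
      ultimately show ?thesis
        using 2(2) by blast
    qed
  qed
qed

end
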